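(* Fix $q\in(2,3]$, let $f,g$ satisfy Assumption (A1), and let $\{x^k\},\{y^k\}$ be generated by Algorithm (Alg) such that Assumption (A2) holds; let $\Gamma,L_g,L_H,\widehat{L}$ be as in the context. Fix $\overline{x}\in\omega(x^0)$. Suppose that $F=f+g$ is a KL function; that the algorithm parameter $\varrho$ satisfies $0<\varrho<\frac{1-\varsigma}{1+\varsigma+L_g}$ for some $\varsigma\in(0,1)$; that there exist $\widehat{\varepsilon}>0$, $\kappa>0$ and $\gamma\in(\frac{1}{q-1},1]$ such that $\mathrm{dist}(x,\mathcal{X}^* )\le\kappa[r(x)]^\gamma$ for all $x\in\mathbb{B}(\overline{x},\widehat{\varepsilon})$; and that there exist $\widetilde{\varepsilon}\in(0,\widehat{\varepsilon})$ and $\widehat{\kappa}\in(0,\kappa^{-1/\gamma})$ such that $$F(x)\ge F(\overline{x})-\frac{\gamma\widehat{\kappa}}{1+\gamma}[\mathrm{dist}(x,\mathcal{S}^* )]^{\frac{1+\gamma}{\gamma}}\quad\text{for all }x\in\mathbb{B}(\overline{x},\widetilde{\varepsilon}).$$ Put $$\eta_0:=1-\varsigma-\varrho(1+\varsigma+L_g),\qquad \eta:=\frac{2+L_HL_m^{-1}}{2\eta_0}+\frac{\sqrt{2L_H(\eta_0L_m)^{-1}+\eta_0^{-2}(2+L_HL_m^{-1})^2}}{2},$$ $$\widehat{c}:=\big[(3+L_g)\varrho\widehat{L}+L_H/2+\widehat{L}\big]\eta^{q-1},\qquad \beta:=\sqrt2\,[\varrho(1+L_g)+1]\widehat{L}+\tfrac{\sqrt2}{2}L_H,$$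 and $\overline{F}:=\lim_{k\to\infty}F(x^k)$. Then there is a constant $\beta_0>0$ such that for all sufficiently large $k$, $$F(x^{k+1})-\overline{F}\le\Big(\frac{2L_H}{3}+\frac{\beta}{\sqrt2}\Big)\eta^{q-1}\max\big\{(\varrho\widehat{L}\eta^{q-1}+\kappa\widehat{c}^{\,\gamma})^3,1\big\}\,[\beta_0(F(x^k)-\overline{F})]^{\gamma(q-1)}.$$ That is, $\{F(x^k)\}$ converges to $\overline{F}$ with $Q$-superlinear rate of order $\gamma(q-1)$.
   Context: $\mathbb{X}$ is a finite-dimensional real vector space with inner product $\langle\cdot,\cdot\rangle$ and induced norm $\|\cdot\|$; $\overline{\mathbb{R}}=(-\infty,\infty]$; $f,g:\mathbb{X}\to\overline{\mathbb{R}}$, $F:=f+g$; $\mathbb{B}(x,\delta)$ is the closed ball. Assumption (A1): $f$ is proper lower semicontinuous (lsc) and twice continuously differentiable on an open set $\mathcal{O}\supset\mathrm{cl}(\mathrm{dom}\,g)$; $g$ is proper, lsc, convex with $\mathrm{dom}\,g\neq\emptyset$; $F$ is bounded below. $\partial$ denotes the limiting (Mordukhovich) subdifferential. $\mathcal{S}^*:=\{x: 0\in\partial F(x)\}$. $\mathrm{prox}_g(x):=\arg\min_z\{\frac12\|z-x\|^2+g(z)\}$. The residual function is $r(x):=\|x-\mathrm{prox}_g(x-\nabla f(x))\|$. The set of second-order stationary points is $\mathcal{X}^*:=\{x\in\mathcal{S}^*:\langle\mathrm{prox}_g(z)-x,\nabla^2f(x)(\mathrm{prox}_g(z)-x)\rangle\ge0\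 \ \forall z\in\mathbb{X}\}$. Algorithm (Alg). Input: $q\in[2,3]$, $0<L_m<L_M$, $\varrho\in(0,1)$, $\sigma\in(0,1)$, $\tau>1$, $x^0\in\mathrm{dom}\,g$. For $k=0,1,2,\dots$, with $\vartheta_k(x):=f(x^k)+\langle\nabla f(x^k),x-x^k\rangle+\frac12\langle\nabla^2f(x^k)(x-x^k),x-x^k\rangle$: 1. Choose $L_{k,0}\in[L_m,L_M]$, with in addition $L_{k,0}>\max(0,-\lambda_{\min}(\nabla^2f(x^k)))$ if $q=2$. 2. For $j=0,1,2,\dots$: let $f_{k,j}(x):=\vartheta_k(x)+\frac{L_{k,j}}{q}\|x-x^k\|^q$, $\Theta_{k,j}:=f_{k,j}+g$, $R_{k,j}(x):=x-\mathrm{prox}_g(x-\nabla f_{k,j}(x))$, $r_{k,j}(x):=\|R_{k,j}(x)\|$. Compute $y^{k,j}$ with $r_{k,j}(y^{k,j})\le\varrho L_{k,j}\|y^{k,j}-x^k\|^{q-1}$ and $\Theta_{k,j}(y^{k,j})\le\Theta_{k,j}(x^k)$. If $F(y^{k,j})\le F(x^k)-\frac{\sigma L_{k,j}}{q}\|y^{k,j}-x^k\|^q$, set $j_k:=j$ and go to step 3; otherwise set $L_{k,j+1}:=\tau L_{k,j}$ and continue with $j+1$. 3. Set $L_k:=L_{k,j_k}$, $y^k:=y^{k,j_k}$, $v^k:=R_{k,j_k}(y^k)$, and $x^{k+1}:=y^k$ if $F(y^k)<F(y^k-v^k)$, $x^{k+1}:=y^k-v^k$ otherwise. The sequence $\{F(x^k)\}$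 is nonincreasing and bounded below, hence convergent. $\omega(x^0)$ denotes the set of accumulation points of $\{x^k\}$. Assumption (A2): (i) $\{x^k\}_{k\in\mathbb{N}}$ is bounded; (ii) $\nabla^2f$ is strictly continuous (i.e. Lipschitz continuous on a neighborhood of each point) on an open convex set $\mathcal{N}$ with $\mathcal{O}\supset\mathcal{N}\supset\omega(x^0)$. Constants. Under (A1)–(A2) one has $\sup_kL_k<\infty$, $y^k-x^k\to0$, $v^k\to0$; $\widehat{L}>0$ denotes a constant with $L_k\le\widehat{L}$ for all $k$. Consequently one can fix a compact convex set $\Gamma\subset\mathcal{N}$, $\overline{\varepsilon}>0$ and $\overline{k}\in\mathbb{N}$ such that for all $k\ge\overline{k}$: $x^k\in\bigcup_{x\in\omega(x^0)}\mathbb{B}(x,\overline{\varepsilon}/2)\subset\bigcup_{x\in\omega(x^0)}\mathbb{B}(x,\overline{\varepsilon})\subset\Gamma$ and $y^k,\,y^k-v^k\in\Gamma$. $L_g>0$ and $L_H>0$ are Lipschitz constants on $\Gamma$ of $\nabla f$ and $\nabla^2f$, respectively. KL function: for $\varpi>0$ let $\Upsilon_\varpi$ be the set of continuous concave $\varphi:[0,\varpi)\to\mathbb{R}_+$ that are continuously differentiable on $(0,\varpi)$ with $\varphi(0)=0$ and $\varphi'>0$ on $(0,\varpi)$. A proper $h:\mathbb{X}\to\overline{\mathbb{R}}$ has the KL property at $\overline{x}\in\mathrm{dom}\,\partial h$ if there are $\delta>0$, $\varpi\in(0,\infty]$, $\varphi\in\Upsilon_\varpi$ with $\varphi'(h(x)-h(\overline{x}))\,\mathrm{dist}(0,\partial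 h(x))\ge1$ for all $x\in\mathbb{B}(\overline{x},\delta)$ with $h(\overline{x})<h(x)<h(\overline{x})+\varpi$. $h$ is a KL function if it has the KL property at every point of $\mathrm{dom}\,\partial h$. *)

theory Defs
  imports "HOL-Analysis.Analysis"
begin

section \<open>Extended-real-valued functions\<close>

text \<open>Functions with values in \<open>(-\<infinity>, \<infinity>]\<close> are total functions into \<^typ>\<open>ereal\<close>; that they avoid
  \<open>-\<infinity>\<close> is part of \<open>proper\<close>.\<close>

definition edom :: "('a \<Rightarrow> ereal) \<Rightarrow> 'a set"
  where "edom h = {x. h x < \<infinity>}"

definition proper :: "('a \<Rightarrow> ereal) \<Rightarrow> bool"
  where "proper h \<longleftrightarrow> (\<forall>x. h x \<noteq> -\<infinity>) \<and> edom h \<noteq> {}"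

definition lsc :: "('a::topological_space \<Rightarrow> ereal) \<Rightarrow> bool"
  where "lsc h \<longleftrightarrow> (\<forall>x. h x \<le> Liminf (at x) h)"

text \<open>The weights are taken in the open interval, so \<open>0 * \<infinity>\<close> never occurs.\<close>

definition econvex :: "('a::real_vector \<Rightarrow> ereal) \<Rightarrow> bool"
  where "econvex h \<longleftrightarrow> (\<forall>x y t. 0 < t \<and> t < 1 \<longrightarrow>
    h ((1 - t) *\<^sub>R x + t *\<^sub>R y) \<le> ereal (1 - t) * h x + ereal t * h y)"

text \<open>Distance to a set with the convention that the distance to the empty set is \<open>\<infinity>\<close>
  (whereas \<^term>\<open>infdist x {} = 0\<close>).\<close>

definition edist_set :: "'a::metric_space \<Rightarrow> 'a set \<Rightarrow> ereal"
  where "edist_set x S = (if S = {} then \<infinity> else ereal (infdist x S))"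

section \<open>Gradient and Hessian\<close>

definition grad :: "('a::euclidean_space \<Rightarrow> real) \<Rightarrow> 'a \<Rightarrow> 'a"
  where "grad h x = (THE D. GDERIV h x :> D)"

definition hess :: "('a::euclidean_space \<Rightarrow> real) \<Rightarrow> 'a \<Rightarrow> 'a \<Rightarrow>\<^sub>L 'a"
  where "hess h x = Blinfun (frechet_derivative (grad h) (at x))"

definition egrad :: "('a::euclidean_space \<Rightarrow> ereal) \<Rightarrow> 'a \<Rightarrow> 'a"
  where "egrad f = grad (\<lambda>x. real_of_ereal (f x))"

definition ehess :: "('a::euclidean_space \<Rightarrow> ereal) \<Rightarrow> 'a \<Rightarrow> 'a \<Rightarrow>\<^sub>L 'a"
  where "ehess f = hess (\<lambda>x. real_of_ereal (f x))"

text \<open>\<open>f\<close> is finite and twice continuously differentiable on the open set \<open>U\<close>.\<close>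

definition C2_on :: "('a::euclidean_space \<Rightarrow> ereal) \<Rightarrow> 'a set \<Rightarrow> bool"
  where "C2_on f U \<longleftrightarrow> open U \<and>
    (\<forall>x\<in>U. \<bar>f x\<bar> \<noteq> \<infinity> \<and> (\<lambda>z. real_of_ereal (f z)) differentiable (at x)
          \<and> egrad f differentiable (at x)) \<and>
    continuous_on U (ehess f)"

definition lambda_min :: "('a::euclidean_space \<Rightarrow>\<^sub>L 'a) \<Rightarrow> real"
  where "lambda_min A = Min {l. \<exists>v. v \<noteq> 0 \<and> blinfun_apply A v = l *\<^sub>R v}"

section \<open>Subdifferentials and stationary points\<close>

definition regular_subdiff :: "('a::euclidean_space \<Rightarrow> ereal) \<Rightarrow> 'a \<Rightarrow> 'a set"
  where "regular_subdiff h x = {v. \<bar>h x\<bar> \<noteq> \<infinity> \<and>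
    0 \<le> Liminf (at x) (\<lambda>z. (h z - h x - ereal (v \<bullet> (z - x))) / ereal (norm (z - x)))}"

definition limiting_subdiff :: "('a::euclidean_space \<Rightarrow> ereal) \<Rightarrow> 'a \<Rightarrow> 'a set"
  where "limiting_subdiff h x = {v. \<bar>h x\<bar> \<noteq> \<infinity> \<and>
    (\<exists>u w. u \<longlonglongrightarrow> x \<and> (\<lambda>n. h (u n)) \<longlonglongrightarrow> h x \<and>
           (\<forall>n::nat. w n \<in> regular_subdiff h (u n)) \<and> w \<longlonglongrightarrow> v)}"

definition prox :: "('a::euclidean_space \<Rightarrow> ereal) \<Rightarrow> 'a \<Rightarrow> 'a"
  where "prox g x = arg_min (\<lambda>z. ereal (1/2 * (norm (z - x))\<^sup>2) + g z) (\<lambda>_. True)"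

definition stationary :: "('a::euclidean_space \<Rightarrow> ereal) \<Rightarrow> ('a \<Rightarrow> ereal) \<Rightarrow> 'a set"
  where "stationary f g = {x. 0 \<in> limiting_subdiff (\<lambda>z. f z + g z) x}"

definition second_order_stationary :: "('a::euclidean_space \<Rightarrow> ereal) \<Rightarrow> ('a \<Rightarrow> ereal) \<Rightarrow> 'a set"
  where "second_order_stationary f g = {x \<in> stationary f g.
    \<forall>z. (prox g z - x) \<bullet> blinfun_apply (ehess f x) (prox g z - x) \<ge> 0}"

definition residual :: "('a::euclidean_space \<Rightarrow> ereal) \<Rightarrow> ('a \<Rightarrow> ereal) \<Rightarrow> 'a \<Rightarrow> real"
  where "residual f g x = norm (x - prox g (x - egrad f x))"

section \<open>Kurdyka--Lojasiewicz functions\<close>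

definition desingularizing :: "ereal \<Rightarrow> (real \<Rightarrow> real) set"
  where "desingularizing w = {\<phi>.
    continuous_on {t. 0 \<le> t \<and> ereal t < w} \<phi> \<and>
    concave_on {t. 0 \<le> t \<and> ereal t < w} \<phi> \<and>
    (\<forall>t. 0 \<le> t \<and> ereal t < w \<longrightarrow> 0 \<le> \<phi> t) \<and>
    \<phi> C1_differentiable_on {t. 0 < t \<and> ereal t < w} \<and>
    \<phi> 0 = 0 \<and>
    (\<forall>t. 0 < t \<and> ereal t < w \<longrightarrow> 0 < deriv \<phi> t)}"

definition KL_at :: "('a::euclidean_space \<Rightarrow> ereal) \<Rightarrow> 'a \<Rightarrow> bool"
  where "KL_at h xb \<longleftrightarrow> (\<exists>\<delta>>0. \<exists>w>0. \<exists>\<phi>\<in>desingularizing w. \<forall>x\<in>cball xb \<delta>.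
    h xb < h x \<and> h x < h xb + w \<longrightarrow>
      ereal (deriv \<phi> (real_of_ereal (h x - h xb))) * edist_set 0 (limiting_subdiff h x) \<ge> 1)"

definition KL_function :: "('a::euclidean_space \<Rightarrow> ereal) \<Rightarrow> bool"
  where "KL_function h \<longleftrightarrow> proper h \<and> (\<forall>x. limiting_subdiff h x \<noteq> {} \<longrightarrow> KL_at h x)"

section \<open>Standing assumptions and the algorithm\<close>

definition assumption_A1 :: "('a::euclidean_space \<Rightarrow> ereal) \<Rightarrow> ('a \<Rightarrow> ereal) \<Rightarrow> 'a set \<Rightarrow> bool"
  where "assumption_A1 f g U \<longleftrightarrow>
    proper f \<and> lsc f \<and> C2_on f U \<and> closure (edom g) \<subseteq> U \<and>
    proper g \<and> lsc g \<and> econvex g \<and>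
    (\<exists>c::real. \<forall>x. ereal c \<le> f x + g x)"

text \<open>The regularized model \<open>f\<^sub>k\<^sub>,\<^sub>j\<close>, with \<open>c = x\<^sup>k\<close> and \<open>L = L\<^sub>k\<^sub>,\<^sub>j\<close>; \<open>0 powr q = 0\<close> makes it correct
  at \<open>z = c\<close>.\<close>

definition f_model :: "('a::euclidean_space \<Rightarrow> ereal) \<Rightarrow> real \<Rightarrow> 'a \<Rightarrow> real \<Rightarrow> 'a \<Rightarrow> real"
  where "f_model f q c L z =
    real_of_ereal (f c) + egrad f c \<bullet> (z - c) + 1/2 * (blinfun_apply (ehess f c) (z - c) \<bullet> (z - c))
    + L / q * norm (z - c) powr q"

definition Theta_model ::
    "('a::euclidean_space \<Rightarrow> ereal) \<Rightarrow> ('a \<Rightarrow> ereal) \<Rightarrow> real \<Rightarrow> 'a \<Rightarrow> real \<Rightarrow> 'a \<Rightarrow> ereal"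
  where "Theta_model f g q c L z = ereal (f_model f q c L z) + g z"

definition R_model ::
    "('a::euclidean_space \<Rightarrow> ereal) \<Rightarrow> ('a \<Rightarrow> ereal) \<Rightarrow> real \<Rightarrow> 'a \<Rightarrow> real \<Rightarrow> 'a \<Rightarrow> 'a"
  where "R_model f g q c L z = z - prox g (z - grad (f_model f q c L) z)"

definition sufficient_decrease ::
    "('a::euclidean_space \<Rightarrow> ereal) \<Rightarrow> ('a \<Rightarrow> ereal) \<Rightarrow> real \<Rightarrow> real \<Rightarrow> 'a \<Rightarrow> real \<Rightarrow> 'a \<Rightarrow> bool"
  where "sufficient_decrease f g q \<sigma> c L y \<longleftrightarrow>
    f y + g y \<le> f c + g c - ereal (\<sigma> * L / q * norm (y - c) powr q)"

text \<open>\<open>x k\<close>, \<open>y k j\<close>, \<open>L k j\<close> and \<open>jk k\<close> are a possible run of the algorithm. The values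
  \<open>y k j\<close> and \<open>L k j\<close> are constrained only for the inner iterations \<open>j \<le> jk k\<close> actually performed.\<close>

definition algorithm_run ::
    "('a::euclidean_space \<Rightarrow> ereal) \<Rightarrow> ('a \<Rightarrow> ereal) \<Rightarrow> real \<Rightarrow> real \<Rightarrow> real \<Rightarrow> real \<Rightarrow> real \<Rightarrow> real \<Rightarrow>
     (nat \<Rightarrow> 'a) \<Rightarrow> (nat \<Rightarrow> nat \<Rightarrow> 'a) \<Rightarrow> (nat \<Rightarrow> nat \<Rightarrow> real) \<Rightarrow> (nat \<Rightarrow> nat) \<Rightarrow> bool"
  where "algorithm_run f g q Lm LM \<rho> \<sigma> \<tau> x y L jk \<longleftrightarrow>
    2 \<le> q \<and> q \<le> 3 \<and> 0 < Lm \<and> Lm < LM \<and> 0 < \<rho> \<and> \<rho> < 1 \<and> 0 < \<sigma> \<and> \<sigma> < 1 \<and> 1 < \<tau> \<and>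
    x 0 \<in> edom g \<and>
    (\<forall>k.
      Lm \<le> L k 0 \<and> L k 0 \<le> LM \<and>
      (q = 2 \<longrightarrow> max 0 (- lambda_min (ehess f (x k))) < L k 0) \<and>
      (\<forall>j\<le>jk k.
        norm (R_model f g q (x k) (L k j) (y k j)) \<le> \<rho> * L k j * norm (y k j - x k) powr (q - 1) \<and>
        Theta_model f g q (x k) (L k j) (y k j) \<le> Theta_model f g q (x k) (L k j) (x k)) \<and>
      (\<forall>j<jk k. \<not> sufficient_decrease f g q \<sigma> (x k) (L k j) (y k j) \<and> L k (Suc j) = \<tau> * L k j) \<and>
      sufficient_decrease f g q \<sigma> (x k) (L k (jk k)) (y k (jk k)) \<and>
      (let yk = y k (jk k);
           vk = R_model f g q (x k) (L k (jk k)) yk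
       in x (Suc k) = (if f yk + g yk < f (yk - vk) + g (yk - vk) then yk else yk - vk)))"

definition accumulation_points :: "(nat \<Rightarrow> 'a::topological_space) \<Rightarrow> 'a set"
  where "accumulation_points x = {z. \<exists>s. strict_mono s \<and> (x \<circ> s) \<longlonglongrightarrow> z}"

definition strictly_continuous_on ::
    "'a::metric_space set \<Rightarrow> ('a \<Rightarrow> 'b::metric_space) \<Rightarrow> bool"
  where "strictly_continuous_on N h \<longleftrightarrow>
    (\<forall>x\<in>N. \<exists>\<delta>>0. \<exists>C. C-lipschitz_on (ball x \<delta> \<inter> N) h)"

definition assumption_A2 ::
    "('a::euclidean_space \<Rightarrow> ereal) \<Rightarrow> 'a set \<Rightarrow> 'a set \<Rightarrow> (nat \<Rightarrow> 'a) \<Rightarrow> bool"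
  where "assumption_A2 f U N x \<longleftrightarrow>
    bounded (range x) \<and>
    open N \<and> convex N \<and> N \<subseteq> U \<and> accumulation_points x \<subseteq> N \<and>
    strictly_continuous_on N (ehess f)"

definition Q_superlinear_of_order :: "(nat \<Rightarrow> real) \<Rightarrow> real \<Rightarrow> real \<Rightarrow> bool"
  where "Q_superlinear_of_order s l p \<longleftrightarrow> 1 < p \<and> s \<longlonglongrightarrow> l \<and>
    (\<exists>C>0. \<forall>\<^sub>F k in sequentially. \<bar>s (Suc k) - l\<bar> \<le> C * \<bar>s k - l\<bar> powr p)"

end

theory Submission
  imports Defs
begin

text \<open>
  Write \<open>t\<^sub>k = \<parallel>y\<^sup>k - x\<^sup>k\<parallel>\<close> for the step length, \<open>X*\<close> for the set of second-order stationary points,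
  \<open>d\<^sub>k\<close> for the distance of \<open>x\<^sup>k\<close> to \<open>X*\<close>, \<open>z\<^sup>k = y\<^sup>k - v\<^sup>k\<close> and \<open>P = \<gamma>(q - 1) > 1\<close>. The factor in front
  of the bracket in the claim is positive, and \<open>\<beta>\<^sub>0\<close> may be chosen freely, so it absorbs every
  multiplicative constant. What has to be shown is that \<open>F(x\<^sup>k\<^sup>+\<^sup>1) - F(xbar) = O((F(x\<^sup>k) - F(xbar))\<^sup>P)\<close> and
  that \<open>F(x\<^sup>k)\<close> tends to \<open>F(xbar)\<close>. Four estimates combine to give it.

  \<^enum> \<open>t\<^sub>k = O(d\<^sub>k)\<close> (\<open>step_length_le_distance\<close>). Both \<open>z\<^sup>k\<close> and a nearby \<open>p \<in> X*\<close> solve inclusions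
    involving \<open>\<partial>g\<close>, and \<open>\<partial>g\<close> is monotone. The resulting inequality contains
    \<open>\<nabla>\<^sup>2f\<close> applied twice to \<open>z\<^sup>k - p\<close>; since \<open>z\<^sup>k\<close> is a proximal point, second-order stationarity of
    \<open>p\<close> bounds this below up to an error proportional to \<open>\<parallel>x\<^sup>k - p\<parallel>\<close>. What survives
    is the regularization term of order \<open>t\<^sub>k\<^sup>q\<close>, which dominates all errors unless \<open>t\<^sub>k\<close> is
    controlled by \<open>\<parallel>x\<^sup>k - p\<parallel>\<close>.

  \<^enum> The residuals at \<open>y\<^sup>k\<close> and \<open>z\<^sup>k\<close> are \<open>O(t\<^sub>k\<^sup>q\<^sup>-\<^sup>1)\<close> (\<open>residual_after_step\<close>), because the model
    gradient differs from \<open>\<nabla>f\<close> by that order. The error bound turns this into distance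
    \<open>O(t\<^sub>k\<^sup>P)\<close> from \<open>X*\<close>. Together with the first estimate, \<open>d\<^sub>k\<close> at least
    halves at each step while the iterates stay near \<open>xbar\<close>, and the moves are \<open>O(d\<^sub>k)\<close>; so once an iterate is very close to its accumulation point \<open>xbar\<close> the
    sequence is trapped and converges to \<open>xbar\<close> (\<open>converges\<close>).

  \<^enum> \<open>F(z\<^sup>k) - F(xbar)\<close> is at most \<open>O(t\<^sub>k\<^sup>q\<^sup>-\<^sup>1 t\<^sub>k\<^sup>P)\<close> (\<open>value_gap_le_step_length\<close>). Compare
    \<open>z\<^sup>k\<close> with a nearby \<open>p \<in> X*\<close>: a subgradient of \<open>F\<close> at \<open>z\<^sup>k\<close> has size \<open>O(t\<^sub>k\<^sup>q\<^sup>-\<^sup>1)\<close>, the second-order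
    term of \<open>f\<close> has the favourable sign, and only a cubic remainder is left. Finally
    \<open>F(p) \<le> F(xbar)\<close>, since by the Kurdyka--Lojasiewicz inequality no stationary point
    near \<open>xbar\<close> can have a value slightly above \<open>F(xbar)\<close> (\<open>KL_stationary_value\<close>).

  \<^enum> \<open>F - F(xbar)\<close> is at least a positive multiple of the distance to \<open>X*\<close> to the power
    \<open>(1 + \<gamma>)/\<gamma>\<close> near \<open>xbar\<close> (\<open>error_bound_imp_growth\<close>). The error bound says that the slope of \<open>F\<close> is
    large away from \<open>X*\<close>, so descent from a point that violated the growth would lead below
    the weak lower bound that is assumed.

  The last two estimates squeeze \<open>F(x\<^sup>k)\<close> towards \<open>F(xbar)\<close>. Moreover \<open>(q - 1) + P\<close> is the product of
  \<open>(1 + \<gamma>)/\<gamma>\<close> and \<open>P\<close>, so chaining the third, the first and the fourth estimate gives the rate.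
\<close>

section \<open>Gradients and one-sided derivatives\<close>

lemma GDERIV_unique:
  fixes h :: "'a::euclidean_space \<Rightarrow> real"
  assumes "GDERIV h x :> D" "GDERIV h x :> E"
  shows "D = E"
proof -
  have "(\<lambda>v. v \<bullet> D) = (\<lambda>v. v \<bullet> E)"
    using assms has_derivative_unique unfolding gderiv_def by blast
  then have "v \<bullet> D = v \<bullet> E" for v by metis
  then show ?thesis by (metis inner_commute vector_eq_rdot)
qed

lemma grad_eqI:
  fixes h :: "'a::euclidean_space \<Rightarrow> real"
  shows "GDERIV h x :> D \<Longrightarrow> grad h x = D"
  unfolding grad_def using GDERIV_unique by blast

lemma GDERIV_grad:
  fixes h :: "'a::euclidean_space \<Rightarrow> real"
  assumes "h differentiable (at x)"
  shows "GDERIV h x :> grad h x"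
proof -
  obtain h' where h': "(h has_derivative h') (at x)" using assms differentiable_def by blast
  interpret bounded_linear h' by (rule has_derivative_bounded_linear[OF h'])
  define D where "D = (\<Sum>b\<in>Basis. h' b *\<^sub>R b)"
  have "h' v = v \<bullet> D" for v
  proof -
    have "h' v = h' (\<Sum>b\<in>Basis. (v \<bullet> b) *\<^sub>R b)" by (simp add: euclidean_representation)
    also have "\<dots> = (\<Sum>b\<in>Basis. (v \<bullet> b) * h' b)" by (simp add: sum scaleR)
    also have "\<dots> = v \<bullet> D" by (simp add: D_def inner_sum_right mult.commute)
    finally show ?thesis .
  qed
  then have "h' = (\<lambda>v. v \<bullet> D)" by auto
  then have "GDERIV h x :> D" using h' by (simp add: gderiv_def)
  then show ?thesis using grad_eqI by blast
qed

lemma hess_has_derivative: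
  fixes h :: "'a::euclidean_space \<Rightarrow> real"
  assumes "grad h differentiable (at x)"
  shows "(grad h has_derivative blinfun_apply (hess h x)) (at x)"
proof -
  have 1: "(grad h has_derivative frechet_derivative (grad h) (at x)) (at x)"
    using assms frechet_derivative_works by blast
  then have "bounded_linear (frechet_derivative (grad h) (at x))"
    using has_derivative_bounded_linear by blast
  then show ?thesis using 1 by (simp add: hess_def bounded_linear_Blinfun_apply)
qed

lemma ray_quotient_tendsto:
  assumes "(F has_derivative F') (at x)"
  shows "((\<lambda>t. (F (x + t *\<^sub>R h) - F x) /\<^sub>R t) \<longlongrightarrow> F' h) (at_right 0)"
proof -
  interpret bounded_linear F' by (rule has_derivative_bounded_linear[OF assms])
  have "((\<lambda>t::real. x + t *\<^sub>R h) has_derivative (\<lambda>t. t *\<^sub>R h)) (at 0 within {0<..})"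
    by (auto intro!: derivative_eq_intros)
  moreover have "(F has_derivative F') (at ((\<lambda>t::real. x + t *\<^sub>R h) 0))" using assms by simp
  ultimately have "((\<lambda>t::real. F (x + t *\<^sub>R h)) has_derivative (\<lambda>t. F' (t *\<^sub>R h))) (at 0 within {0<..})"
    using has_derivative_compose by blast
  then have "((\<lambda>t. norm (F (x + t *\<^sub>R h) - F x - F' (t *\<^sub>R h)) / norm t) \<longlongrightarrow> 0) (at_right 0)"
    unfolding has_derivative_iff_norm by (simp add: at_within_def)
  then have "((\<lambda>t. norm ((F (x + t *\<^sub>R h) - F x) /\<^sub>R t - F' h)) \<longlongrightarrow> 0) (at_right 0)"
  proof (rule Lim_transform_eventually)
    have "norm (F (x + t *\<^sub>R h) - F x - F' (t *\<^sub>R h)) / norm t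
        = norm ((F (x + t *\<^sub>R h) - F x) /\<^sub>R t - F' h)" if "0 < t" for t
    proof -
      have "(F (x + t *\<^sub>R h) - F x) /\<^sub>R t - F' h = (F (x + t *\<^sub>R h) - F x - F' (t *\<^sub>R h)) /\<^sub>R t"
        using that by (simp add: scaleR scaleR_diff_right)
      then show ?thesis using that by (simp add: divide_inverse mult.commute)
    qed
    then show "\<forall>\<^sub>F t in at_right 0. norm (F (x + t *\<^sub>R h) - F x - F' (t *\<^sub>R h)) / norm t
        = norm ((F (x + t *\<^sub>R h) - F x) /\<^sub>R t - F' h)"
      by (rule eventually_mono[OF eventually_at_right_less])
  qed
  then show ?thesis using tendsto_norm_zero_iff LIM_zero_iff by blast
qed

section \<open>Taylor estimates with a Lipschitz Hessian\<close>

text \<open>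
  The first-order remainder of a map with Lipschitz derivative. The sharp constant would be
  \<open>C / 2\<close>; the mean value inequality gives \<open>C\<close> at once, and only the order matters here.
\<close>

lemma gradient_taylor:
  fixes df :: "'a::euclidean_space \<Rightarrow> 'a"
  assumes "convex S" and df: "\<And>z. z \<in> S \<Longrightarrow> (df has_derivative blinfun_apply (H z)) (at z)"
    and H: "C-lipschitz_on S H" and x: "x \<in> S" and p: "p \<in> S"
  shows "norm (df p - df x - H x (p - x)) \<le> C * norm (p - x)^2"
proof -
  have sub: "closed_segment x p \<subseteq> S" using assms by (simp add: closed_segment_subset)
  have "norm (df p - df x - H x (p - x)) \<le> norm (p - x) * (C * norm (p - x))"
  proof (rule differentiable_bound_linearization[where S = "closed_segment x p"
        and f' = "\<lambda>z. blinfun_apply (H z)"])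
    show "x + t *\<^sub>R (p - x) \<in> closed_segment x p" if "t \<in> {0..1}" for t
      using that by (auto simp: in_segment algebra_simps intro!: exI[of _ t])
    show "(df has_derivative blinfun_apply (H z)) (at z within closed_segment x p)"
      if "z \<in> closed_segment x p" for z
      using that sub df has_derivative_at_withinI by blast
    show "onorm (blinfun_apply (H z) - blinfun_apply (H x)) \<le> C * norm (p - x)"
      if z: "z \<in> closed_segment x p" for z
    proof -
      have "blinfun_apply (H z) - blinfun_apply (H x) = blinfun_apply (H z - H x)"
        by (auto simp: fun_eq_iff blinfun.diff_left)
      then have "onorm (blinfun_apply (H z) - blinfun_apply (H x)) = dist (H z) (H x)"
        by (simp add: norm_blinfun.rep_eq dist_norm)
      also have "\<dots> \<le> C * dist z x" using z sub x lipschitz_onD[OF H] by blast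
      also have "\<dots> \<le> C * norm (p - x)"
        using z lipschitz_on_nonneg[OF H] segment_bound1[of z x p]
        by (intro mult_left_mono) (auto simp: dist_norm norm_minus_commute)
      finally show ?thesis .
    qed
  qed simp
  then show ?thesis by (simp add: power2_eq_square mult_ac)
qed

text \<open>
  Integrating the gradient estimate along the segment. Working on the segment avoids differentiating
  the quadratic form, so that the symmetry of \<open>H\<close> can be deduced from this estimate below.
\<close>

lemma value_taylor:
  fixes F :: "'a::euclidean_space \<Rightarrow> real"
  assumes "convex S" and F: "\<And>z. z \<in> S \<Longrightarrow> (F has_derivative (\<lambda>h. h \<bullet> df z)) (at z)"
    and df: "\<And>z. z \<in> S \<Longrightarrow> (df has_derivative blinfun_apply (H z)) (at z)"
    and H: "C-lipschitz_on S H" and x: "x \<in> S" and p: "p \<in> S"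
  shows "\<bar>F p - F x - df x \<bullet> (p - x) - 1/2 * (H x (p - x) \<bullet> (p - x))\<bar> \<le> C * norm (p - x)^3"
proof -
  define h where "h = p - x"
  define \<psi> where "\<psi> t = F (x + t *\<^sub>R h) - t * (df x \<bullet> h) - t^2 / 2 * (H x h \<bullet> h)" for t
  have C: "0 \<le> C" using lipschitz_on_nonneg[OF H] .
  have inS: "x + t *\<^sub>R h \<in> S" if "t \<in> {0..1}" for t
  proof -
    have "x + t *\<^sub>R h = (1 - t) *\<^sub>R x + t *\<^sub>R p" by (simp add: h_def algebra_simps)
    then show ?thesis using that assms(1) x p by (simp add: convexD)
  qed
  have "norm (\<psi> 1 - \<psi> 0) \<le> (C * norm h^3) * norm (1 - 0::real)"
  proof (rule differentiable_bound[where S = "{0..1}"])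
    fix t :: real assume t: "t \<in> {0..1}"
    have l: "((\<lambda>t::real. x + t *\<^sub>R h) has_derivative (\<lambda>t. t *\<^sub>R h)) (at t within {0..1})"
      by (auto intro!: derivative_eq_intros)
    have "((\<lambda>t. F (x + t *\<^sub>R h)) has_derivative (\<lambda>s. (s *\<^sub>R h) \<bullet> df (x + t *\<^sub>R h))) (at t within {0..1})"
      using has_derivative_compose[OF l F[OF inS[OF t]]] by simp
    then show "(\<psi> has_derivative (\<lambda>s. s * ((df (x + t *\<^sub>R h) - df x - H x (t *\<^sub>R h)) \<bullet> h))) (at t within {0..1})"
      unfolding \<psi>_def
      by (auto intro!: derivative_eq_intros simp: fun_eq_iff inner_diff_left blinfun.scaleR_right
          inner_commute algebra_simps)
    have "\<bar>(df (x + t *\<^sub>R h) - df x - H x (t *\<^sub>R h)) \<bullet> h\<bar>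
        \<le> norm (df (x + t *\<^sub>R h) - df x - H x (t *\<^sub>R h)) * norm h" by (rule Cauchy_Schwarz_ineq2)
    also have "\<dots> \<le> (C * norm (t *\<^sub>R h)^2) * norm h"
      using gradient_taylor[OF assms(1) df H x inS[OF t]] by (intro mult_right_mono) auto
    also have "\<dots> = t^2 * (C * norm h ^ 3)"
      by (simp add: power_mult_distrib power2_eq_square power3_eq_cube)
    also have "\<dots> \<le> 1 * (C * norm h ^ 3)"
      using t C by (intro mult_right_mono) (auto simp: power_le_one)
    finally have b: "\<bar>(df (x + t *\<^sub>R h) - df x - H x (t *\<^sub>R h)) \<bullet> h\<bar> \<le> C * norm h^3" by simp
    show "onorm (\<lambda>s. s * ((df (x + t *\<^sub>R h) - df x - H x (t *\<^sub>R h)) \<bullet> h)) \<le> C * norm h^3"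
      by (rule onorm_bound) (use b C in \<open>auto simp: abs_mult mult.commute intro: mult_left_mono\<close>)
  qed auto
  then show ?thesis by (simp add: \<psi>_def h_def)
qed

text \<open>
  The second difference of \<open>F\<close> in the directions \<open>u\<close> and \<open>v\<close> is symmetric in them, and
  two applications of the Taylor estimates identify it with \<open>t\<^sup>2 (H x u \<bullet> v)\<close> up to \<open>O(t\<^sup>3)\<close>.
\<close>

lemma Hessian_symmetric:
  fixes F :: "'a::euclidean_space \<Rightarrow> real"
  assumes S: "convex S" and F: "\<And>z. z \<in> S \<Longrightarrow> (F has_derivative (\<lambda>h. h \<bullet> df z)) (at z)"
    and df: "\<And>z. z \<in> S \<Longrightarrow> (df has_derivative blinfun_apply (H z)) (at z)"
    and H: "C-lipschitz_on S H" and x: "x \<in> interior S"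
  shows "H x u \<bullet> v = H x v \<bullet> u"
proof -
  obtain e where e: "e > 0" "ball x e \<subseteq> S" using x mem_interior by blast
  have xS: "x \<in> S" using x interior_subset by blast
  have C: "0 \<le> C" using lipschitz_on_nonneg[OF H] .
  define \<Delta> where "\<Delta> t u v = F (x + t *\<^sub>R u + t *\<^sub>R v) - F (x + t *\<^sub>R u) - F (x + t *\<^sub>R v) + F x"
    for t :: real and u v :: 'a
  have key: "\<bar>\<Delta> t u v - t^2 * (H x u \<bullet> v)\<bar>
      \<le> t^3 * (C * (2 * norm v ^ 3 + norm u^2 * norm v + norm u * norm v^2))"
    if t: "0 < t" and small: "t * (norm u + norm v) < e" for t u v
  proof -
    have tu: "x + t *\<^sub>R u \<in> S"
    proof -
      have "norm (t *\<^sub>R u) \<le> t * (norm u + norm v)" using t by (auto intro!: mult_left_mono)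
      then show ?thesis using small e by (auto simp: dist_norm)
    qed
    have tv: "x + t *\<^sub>R v \<in> S"
    proof -
      have "norm (t *\<^sub>R v) \<le> t * (norm u + norm v)" using t by (auto intro!: mult_left_mono)
      then show ?thesis using small e by (auto simp: dist_norm)
    qed
    have tuv: "x + t *\<^sub>R u + t *\<^sub>R v \<in> S"
    proof -
      have "norm (t *\<^sub>R u + t *\<^sub>R v) \<le> t * (norm u + norm v)"
        using t by (intro order_trans[OF norm_triangle_ineq]) (auto simp: algebra_simps)
      moreover have "dist x (x + t *\<^sub>R u + t *\<^sub>R v) = norm (t *\<^sub>R u + t *\<^sub>R v)"
        by (simp add: dist_norm algebra_simps flip: norm_minus_cancel[of "- (t *\<^sub>R u) - t *\<^sub>R v"])
      ultimately show ?thesis using small e by auto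
    qed
    have 1: "\<bar>F (x + t *\<^sub>R u + t *\<^sub>R v) - F (x + t *\<^sub>R u) - df (x + t *\<^sub>R u) \<bullet> (t *\<^sub>R v)
        - 1/2 * (H (x + t *\<^sub>R u) (t *\<^sub>R v) \<bullet> (t *\<^sub>R v))\<bar> \<le> t^3 * (C * norm v ^ 3)"
      using value_taylor[OF S F df H tu tuv] t by (simp add: power_mult_distrib mult_ac)
    have 2: "\<bar>F (x + t *\<^sub>R v) - F x - df x \<bullet> (t *\<^sub>R v) - 1/2 * (H x (t *\<^sub>R v) \<bullet> (t *\<^sub>R v))\<bar>
        \<le> t^3 * (C * norm v ^ 3)"
      using value_taylor[OF S F df H xS tv] t by (simp add: power_mult_distrib mult_ac)
    have 3: "\<bar>(df (x + t *\<^sub>R u) - df x - H x (t *\<^sub>R u)) \<bullet> (t *\<^sub>R v)\<bar> \<le> t^3 * (C * (norm u^2 * norm v))"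
    proof -
      have "norm (df (x + t *\<^sub>R u) - df x - H x (t *\<^sub>R u)) \<le> C * (t^2 * norm u^2)"
        using gradient_taylor[OF S df H xS tu] t by (simp add: power_mult_distrib)
      then have "norm (df (x + t *\<^sub>R u) - df x - H x (t *\<^sub>R u)) * norm (t *\<^sub>R v)
          \<le> C * (t^2 * norm u^2) * norm (t *\<^sub>R v)" by (intro mult_right_mono) auto
      also have "\<dots> = t^3 * (C * (norm u^2 * norm v))"
        using t by (simp add: power2_eq_square power3_eq_cube)
      finally show ?thesis by (rule order_trans[OF Cauchy_Schwarz_ineq2])
    qed
    have 4: "\<bar>(H (x + t *\<^sub>R u) - H x) (t *\<^sub>R v) \<bullet> (t *\<^sub>R v)\<bar> \<le> t^3 * (C * (norm u * norm v^2))"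
    proof -
      have "norm (H (x + t *\<^sub>R u) - H x) \<le> C * (t * norm u)"
        using lipschitz_onD[OF H tu xS] t by (simp add: dist_norm)
      then have "norm ((H (x + t *\<^sub>R u) - H x) (t *\<^sub>R v)) \<le> C * (t * norm u) * norm (t *\<^sub>R v)"
        using norm_blinfun[of "H (x + t *\<^sub>R u) - H x" "t *\<^sub>R v"] by (meson mult_right_mono norm_ge_zero order_trans)
      then have "norm ((H (x + t *\<^sub>R u) - H x) (t *\<^sub>R v)) * norm (t *\<^sub>R v)
          \<le> C * (t * norm u) * norm (t *\<^sub>R v) * norm (t *\<^sub>R v)" by (intro mult_right_mono) auto
      also have "\<dots> = t^3 * (C * (norm u * norm v^2))"
        using t by (simp add: power2_eq_square power3_eq_cube)
      finally show ?thesis by (rule order_trans[OF Cauchy_Schwarz_ineq2])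
    qed
    have "\<Delta> t u v - t^2 * (H x u \<bullet> v) =
       (F (x + t *\<^sub>R u + t *\<^sub>R v) - F (x + t *\<^sub>R u) - df (x + t *\<^sub>R u) \<bullet> (t *\<^sub>R v)
        - 1/2 * (H (x + t *\<^sub>R u) (t *\<^sub>R v) \<bullet> (t *\<^sub>R v)))
       - (F (x + t *\<^sub>R v) - F x - df x \<bullet> (t *\<^sub>R v) - 1/2 * (H x (t *\<^sub>R v) \<bullet> (t *\<^sub>R v)))
       + (df (x + t *\<^sub>R u) - df x - H x (t *\<^sub>R u)) \<bullet> (t *\<^sub>R v)
       + 1/2 * ((H (x + t *\<^sub>R u) - H x) (t *\<^sub>R v) \<bullet> (t *\<^sub>R v))"
      by (simp add: \<Delta>_def blinfun.diff_left blinfun.scaleR_right inner_diff_left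
          power2_eq_square algebra_simps)
    moreover have "0 \<le> t^3 * (C * (norm u * norm v^2))" using t C by simp
    ultimately show ?thesis using 1 2 3 4 by (simp add: algebra_simps)
  qed
  define M where "M = C * (2 * norm v ^ 3 + norm u^2 * norm v + norm u * norm v^2)
    + C * (2 * norm u ^ 3 + norm v^2 * norm u + norm v * norm u^2)"
  have "\<bar>H x u \<bullet> v - H x v \<bullet> u\<bar> \<le> t * M" if t: "0 < t" "t * (norm u + norm v) < e" for t
  proof -
    have "\<Delta> t v u = \<Delta> t u v" by (simp add: \<Delta>_def algebra_simps)
    then have "\<bar>t^2 * (H x u \<bullet> v - H x v \<bullet> u)\<bar> \<le> t^3 * M"
      using key[of t u v] key[of t v u] t by (simp add: M_def algebra_simps)
    then have "t^2 * \<bar>H x u \<bullet> v - H x v \<bullet> u\<bar> \<le> t^2 * (t * M)"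
      by (simp add: abs_mult power2_eq_square power3_eq_cube mult_ac)
    then show ?thesis using t by simp
  qed
  then have "\<forall>\<^sub>F t in at_right 0. \<bar>H x u \<bullet> v - H x v \<bullet> u\<bar> \<le> t * M"
    unfolding eventually_at_right_field
    using e by (intro exI[of _ "e / (norm u + norm v + 1)"])
      (auto simp: field_simps add_pos_nonneg intro: le_less_trans[rotated])
  moreover have "((\<lambda>t. t * M) \<longlongrightarrow> 0 * M) (at_right 0)" by (intro tendsto_intros)
  ultimately have "\<bar>H x u \<bullet> v - H x v \<bullet> u\<bar> \<le> 0 * M"
    by (intro tendsto_lowerbound) auto
  then show ?thesis by simp
qed

lemma derivative_norm_le_Lipschitz:
  fixes df :: "'a::euclidean_space \<Rightarrow> 'a"
  assumes df: "(df has_derivative blinfun_apply A) (at x)"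
    and K: "K-lipschitz_on S df" and x: "x \<in> interior S"
  shows "norm (A v) \<le> K * norm v"
proof -
  obtain e where e: "e > 0" "ball x e \<subseteq> S" using x mem_interior by blast
  have xS: "x \<in> S" using x interior_subset by blast
  have "\<forall>\<^sub>F t in at_right 0. norm ((df (x + t *\<^sub>R v) - df x) /\<^sub>R t) \<le> K * norm v"
    unfolding eventually_at_right_field
  proof (intro exI[of _ "e / (norm v + 1)"] conjI allI impI)
    show "0 < e / (norm v + 1)" using e by (simp add: add_nonneg_pos)
    fix t :: real assume t: "0 < t" "t < e / (norm v + 1)"
    then have "t * (norm v + 1) < e" by (subst (asm) pos_less_divide_eq) (auto simp: add_nonneg_pos)
    then have "t * norm v + t < e" by (simp add: algebra_simps)
    then have "x + t *\<^sub>R v \<in> S" using e t by (auto simp: dist_norm)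
    then have "norm (df (x + t *\<^sub>R v) - df x) \<le> K * (t * norm v)"
      using lipschitz_onD[OF K \<open>x + t *\<^sub>R v \<in> S\<close> xS] t by (simp add: dist_norm)
    then have "norm (df (x + t *\<^sub>R v) - df x) * inverse t \<le> K * (t * norm v) * inverse t"
      using t by (intro mult_right_mono) auto
    also have "\<dots> = K * norm v" using t by simp
    finally show "norm ((df (x + t *\<^sub>R v) - df x) /\<^sub>R t) \<le> K * norm v"
      using t unfolding norm_scaleR by (simp only: mult.commute abs_inverse abs_of_pos)
  qed
  then show ?thesis using Lim_norm_ubound[OF _ ray_quotient_tendsto[OF df]] by simp
qed

section \<open>The gradient of the regularized model\<close>

lemma GDERIV_norm_powr:
  fixes c :: "'a::euclidean_space"
  assumes "q > 1"
  shows "GDERIV (\<lambda>z. norm (z - c) powr q) z :> (q * norm (z - c) powr (q - 2)) *\<^sub>R (z - c)"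
proof (cases "z = c")
  case True
  have lim: "((\<lambda>y. norm (y - c) powr (q - 1)) \<longlongrightarrow> 0) (at c)"
  proof -
    have "((\<lambda>y. norm (y - c) powr (q - 1)) \<longlongrightarrow> norm (c - c) powr (q - 1)) (at c)"
      using assms by (intro tendsto_intros) auto
    then show ?thesis by simp
  qed
  have "((\<lambda>y. norm (norm (y - c) powr q - norm (c - c) powr q - (y - c) \<bullet> 0) / norm (y - c)) \<longlongrightarrow> 0) (at c)"
    by (rule Lim_transform_eventually[OF lim]) (auto simp: eventually_at_filter powr_diff)
  then have "((\<lambda>z. norm (z - c) powr q) has_derivative (\<lambda>h. h \<bullet> 0)) (at c)"
    unfolding has_derivative_iff_norm by (auto intro: bounded_linear_zero)
  then show ?thesis using True by (simp add: gderiv_def)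
next
  case False
  have d1: "((\<lambda>z. z - c) has_derivative (\<lambda>h. h)) (at z)" by (auto intro!: derivative_eq_intros)
  have "((\<lambda>z. norm (z - c)) has_derivative (\<lambda>h. h \<bullet> sgn (z - c))) (at z)"
    using has_derivative_compose[OF d1 has_derivative_norm[of "z - c"]] False by simp
  then have "((\<lambda>z. norm (z - c) powr q) has_derivative
      (\<lambda>h. (h \<bullet> sgn (z - c)) * (q * norm (z - c) powr (q - 1)))) (at z)"
    using False by (auto intro!: derivative_eq_intros simp: field_simps powr_diff)
  moreover have "(h \<bullet> sgn (z - c)) * (q * norm (z - c) powr (q - 1))
      = h \<bullet> ((q * norm (z - c) powr (q - 2)) *\<^sub>R (z - c))" for h
  proof -
    have "norm (z - c) powr (q - 1) = norm (z - c) powr (q - 2) * norm (z - c)"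
      using powr_add[of "norm (z - c)" "q - 2" 1] False by simp
    then show ?thesis using False by (simp add: sgn_div_norm)
  qed
  ultimately show ?thesis by (simp add: gderiv_def)
qed

text \<open>
  Without symmetry of the Hessian the quadratic form would contribute only its symmetric part, which
  could not be compared with the derivative of \<open>\<nabla>f\<close>.
\<close>

lemma grad_f_model:
  fixes f :: "'a::euclidean_space \<Rightarrow> ereal"
  assumes "q > 1" and sym: "\<And>u v. ehess f c u \<bullet> v = ehess f c v \<bullet> u"
  shows "grad (f_model f q c L) z
    = egrad f c + ehess f c (z - c) + (L * norm (z - c) powr (q - 2)) *\<^sub>R (z - c)"
proof (rule grad_eqI)
  let ?H = "blinfun_apply (ehess f c)"
  have d1: "((\<lambda>z. z - c) has_derivative (\<lambda>h. h)) (at z)" by (auto intro!: derivative_eq_intros)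
  have d2: "((\<lambda>z. ?H (z - c)) has_derivative ?H) (at z)"
    by (auto intro!: derivative_eq_intros)
  have "((\<lambda>z. ?H (z - c) \<bullet> (z - c)) has_derivative (\<lambda>h. ?H (z - c) \<bullet> h + ?H h \<bullet> (z - c))) (at z)"
    by (rule has_derivative_inner[OF d2 d1])
  then have "((\<lambda>z. 1/2 * (?H (z - c) \<bullet> (z - c))) has_derivative
      (\<lambda>h. 1/2 * (?H (z - c) \<bullet> h + ?H h \<bullet> (z - c)))) (at z)"
    by (rule has_derivative_mult_right)
  moreover have "1/2 * (?H (z - c) \<bullet> h + ?H h \<bullet> (z - c)) = h \<bullet> ?H (z - c)" for h
    using sym[of h "z - c"] by (simp add: inner_commute)
  ultimately have 2: "GDERIV (\<lambda>z. 1/2 * (?H (z - c) \<bullet> (z - c))) z :> ?H (z - c)"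
    by (simp add: gderiv_def)
  have 1: "GDERIV (\<lambda>z. real_of_ereal (f c) + egrad f c \<bullet> (z - c)) z :> egrad f c"
    unfolding gderiv_def by (auto intro!: derivative_eq_intros simp: inner_commute)
  have 3: "GDERIV (\<lambda>z. L / q * norm (z - c) powr q) z :> (L * norm (z - c) powr (q - 2)) *\<^sub>R (z - c)"
    using has_derivative_mult_right[OF GDERIV_norm_powr[OF assms(1), of c z, unfolded gderiv_def], of "L / q"]
      assms(1) by (simp add: gderiv_def mult_ac)
  show "GDERIV (f_model f q c L) z :>
      egrad f c + ehess f c (z - c) + (L * norm (z - c) powr (q - 2)) *\<^sub>R (z - c)"
    using GDERIV_add[OF GDERIV_add[OF 1 2] 3] by (simp add: f_model_def[abs_def])
qed

section \<open>Minimization of lower semicontinuous functions\<close>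

lemma lsc_closed_sublevel:
  assumes "lsc h" shows "closed {z. h z \<le> c}"
proof -
  have "\<exists>T. open T \<and> x \<in> T \<and> T \<subseteq> {z. c < h z}" if "c < h x" for x
  proof -
    have "c < Liminf (at x) h" using that assms unfolding lsc_def by (metis less_le_trans)
    then have "\<forall>\<^sub>F z in at x. c < h z" by (rule less_LiminfD)
    then obtain T where "open T" "x \<in> T" "\<forall>z\<in>T. z \<noteq> x \<longrightarrow> c < h z"
      unfolding eventually_at_topological by blast
    then show ?thesis using that by (intro exI[of _ T]) auto
  qed
  then have "open {z. c < h z}" by (subst open_subopen) auto
  moreover have "{z. h z \<le> c} = - {z. c < h z}" by auto
  ultimately show ?thesis by auto
qed

text \<open>
  A minimizing sequence has a convergent subsequence, and the closed sublevel sets of \<open>h\<close> carry the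
  bound over to the limit. The real-valued part \<open>c\<close> is constrained on \<open>K\<close> only, which suits
  objectives such as \<open>f + g\<close> whose smooth part is controlled locally.
\<close>

lemma lsc_plus_continuous_attains_min:
  fixes h :: "'a::euclidean_space \<Rightarrow> ereal" and c :: "'a \<Rightarrow> real"
  assumes h: "lsc h" and ninf: "\<And>z. h z \<noteq> -\<infinity>"
    and K: "compact K" and c: "continuous_on K c" and ne: "K \<inter> edom h \<noteq> {}"
  shows "\<exists>u\<in>K \<inter> edom h. \<forall>z\<in>K \<inter> edom h. c u + real_of_ereal (h u) \<le> c z + real_of_ereal (h z)"
proof -
  define \<Phi> where "\<Phi> z = ereal (c z) + h z" for z
  obtain z0 where z0: "z0 \<in> K" "h z0 < \<infinity>" using ne by (auto simp: edom_def)
  obtain v where v: "\<And>n. v n \<in> \<Phi> ` K" "v \<longlonglongrightarrow> Inf (\<Phi> ` K)"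
    using Inf_as_limit[of "\<Phi> ` K"] z0 by blast
  have "\<forall>n. \<exists>z. z \<in> K \<and> v n = \<Phi> z" using v(1) by blast
  then obtain w where w: "\<And>n. w n \<in> K" "\<And>n. v n = \<Phi> (w n)" by metis
  obtain u r where u: "u \<in> K" "strict_mono r" "(w \<circ> r) \<longlonglongrightarrow> u"
    using K w(1) unfolding compact_def by meson
  have vr: "(\<lambda>n. \<Phi> (w (r n))) \<longlonglongrightarrow> Inf (\<Phi> ` K)"
    using LIMSEQ_subseq_LIMSEQ[OF v(2) u(2)] w(2) by (simp add: o_def)
  have cr: "(\<lambda>n. c (w (r n))) \<longlonglongrightarrow> c u"
    using continuous_on_tendsto_compose[OF c u(3) u(1)] w(1) by (simp add: o_def)
  have bound: "h u \<le> ereal (M - c u + e)" if M: "Inf (\<Phi> ` K) < ereal M" and e: "e > 0" for M e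
  proof -
    have "\<forall>\<^sub>F n in sequentially. \<Phi> (w (r n)) < ereal M" using order_tendstoD(2)[OF vr M] .
    moreover have "\<forall>\<^sub>F n in sequentially. c u - e < c (w (r n))"
      using order_tendstoD(1)[OF cr, of "c u - e"] e by simp
    ultimately have "\<forall>\<^sub>F n in sequentially. (w \<circ> r) n \<in> {z. h z \<le> ereal (M - c u + e)}"
    proof eventually_elim
      case (elim n)
      then show ?case unfolding \<Phi>_def using ninf[of "w (r n)"] by (cases "h (w (r n))") auto
    qed
    then have "u \<in> {z. h z \<le> ereal (M - c u + e)}"
      using Lim_in_closed_set[OF lsc_closed_sublevel[OF h] _ _ u(3)] by simp
    then show ?thesis by simp
  qed
  have fin0: "\<bar>h z\<bar> \<noteq> \<infinity>" if "z \<in> edom h" for z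
    using that ninf[of z] by (cases "h z") (auto simp: edom_def)
  have "Inf (\<Phi> ` K) \<le> \<Phi> z0" using z0(1) by (rule INF_lower)
  also have "\<Phi> z0 < ereal (c z0 + real_of_ereal (h z0) + 1)"
    using z0(2) ninf[of z0] by (cases "h z0") (auto simp: \<Phi>_def)
  finally have "h u \<le> ereal (c z0 + real_of_ereal (h z0) + 1 - c u + 1)" by (rule bound) simp
  then have "h u < \<infinity>" by (rule le_less_trans) simp
  then have uD: "u \<in> K \<inter> edom h" using u(1) by (simp add: edom_def)
  have "c u + real_of_ereal (h u) \<le> c z + real_of_ereal (h z)" if z: "z \<in> K \<inter> edom h" for z
  proof (rule field_le_epsilon)
    fix e :: real assume e: "e > 0"
    have hz: "h z = ereal (real_of_ereal (h z))" "h u = ereal (real_of_ereal (h u))"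
      using fin0 z uD by (auto simp: ereal_real)
    have "\<Phi> z = ereal (c z + real_of_ereal (h z))" by (subst \<Phi>_def, subst hz(1)) simp
    then have "Inf (\<Phi> ` K) < ereal (c z + real_of_ereal (h z) + e / 2)"
      using e z INF_lower[of z K \<Phi>] by (metis IntD1 add.right_neutral add_strict_left_mono half_gt_zero
          le_less_trans less_ereal.simps(1))
    then have "h u \<le> ereal (c z + real_of_ereal (h z) + e / 2 - c u + e / 2)"
      using bound e by (metis half_gt_zero)
    then show "c u + real_of_ereal (h u) \<le> c z + real_of_ereal (h z) + e"
      by (subst (asm) hz(2)) simp
  qed
  then show ?thesis using uD by blast
qed

section \<open>The proximal map of a convex function\<close>

lemma nonneg_of_quadratic:
  fixes A B :: real
  assumes "\<And>t. 0 < t \<Longrightarrow> t < 1 \<Longrightarrow> 0 \<le> t * A + t^2 * B"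
  shows "0 \<le> A"
proof -
  have "0 \<le> A + t * B" if "0 < t" "t < 1" for t
  proof -
    have "0 \<le> t * (A + t * B)" using assms[OF that] by (simp add: power2_eq_square algebra_simps)
    then show ?thesis using that by (simp add: zero_le_mult_iff)
  qed
  then have "\<forall>\<^sub>F t in at_right 0. 0 \<le> A + t * B"
    unfolding eventually_at_right_field by (intro exI[of _ 1]) auto
  moreover have "((\<lambda>t. A + t * B) \<longlongrightarrow> A + 0 * B) (at_right 0)" by (intro tendsto_intros)
  ultimately have "0 \<le> A + 0 * B" by (intro tendsto_lowerbound) auto
  then show ?thesis by simp
qed

locale lsc_convex =
  fixes g :: "'a::euclidean_space \<Rightarrow> ereal"
  assumes g_proper: "proper g" and g_lsc: "lsc g" and g_convex: "econvex g"
begin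

abbreviation D where "D \<equiv> edom g"
abbreviation gr where "gr z \<equiv> real_of_ereal (g z)"

text \<open>
  The convex subdifferential of \<open>g\<close>, written with real values on the domain: outside it the
  inequality is vacuous because \<open>g\<close> is infinite there.
\<close>

definition subgradient :: "'a \<Rightarrow> 'a \<Rightarrow> bool"
  where "subgradient p v \<longleftrightarrow> p \<in> D \<and> (\<forall>w\<in>D. v \<bullet> (w - p) \<le> gr w - gr p)"

lemma g_not_MInf: "g z \<noteq> -\<infinity>"
  using g_proper by (simp add: proper_def)

lemma D_nonempty: "D \<noteq> {}"
  using g_proper by (simp add: proper_def)

lemma g_eq_ereal: "z \<in> D \<Longrightarrow> g z = ereal (gr z)"
  using g_not_MInf[of z] by (cases "g z") (auto simp: edom_def)

lemma convex_combination:
  assumes z: "z \<in> D" and w: "w \<in> D" and t: "0 \<le> t" "t \<le> 1"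
  shows "(1 - t) *\<^sub>R z + t *\<^sub>R w \<in> D"
    and "gr ((1 - t) *\<^sub>R z + t *\<^sub>R w) \<le> (1 - t) * gr z + t * gr w"
proof -
  have *: "g ((1 - t) *\<^sub>R z + t *\<^sub>R w) \<le> ereal ((1 - t) * gr z + t * gr w)"
  proof (cases "t = 0 \<or> t = 1")
    case True
    then show ?thesis using g_eq_ereal z w by auto
  next
    case False
    then have "g ((1 - t) *\<^sub>R z + t *\<^sub>R w) \<le> ereal (1 - t) * g z + ereal t * g w"
      using g_convex t unfolding econvex_def by simp
    then show ?thesis using g_eq_ereal[OF z] g_eq_ereal[OF w] by (metis plus_ereal.simps(1) times_ereal.simps(1))
  qed
  then show m: "(1 - t) *\<^sub>R z + t *\<^sub>R w \<in> D" by (auto simp: edom_def intro: le_less_trans)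
  show "gr ((1 - t) *\<^sub>R z + t *\<^sub>R w) \<le> (1 - t) * gr z + t * gr w"
    using * by (subst (asm) g_eq_ereal[OF m]) simp
qed

lemma segment_point:
  assumes z: "z \<in> D" and w: "w \<in> D" and t: "0 \<le> t" "t \<le> 1"
  shows "z + t *\<^sub>R (w - z) \<in> D" "gr (z + t *\<^sub>R (w - z)) \<le> gr z + t * (gr w - gr z)"
  using convex_combination[OF assms] by (auto simp: algebra_simps)

text \<open>
  Convexity bounds \<open>g\<close> below by a linear function of the distance to a point \<open>z0\<close> of the domain: a
  value at a far point \<open>w\<close> is controlled from below by the minimum on the unit ball around \<open>z0\<close>, which
  the segment from \<open>z0\<close> to \<open>w\<close> must cross. The quadratic term therefore wins outside a large ball,
  and inside it compactness applies.
\<close>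

lemma prox_objective_attained:
  "\<exists>p\<in>D. \<forall>w\<in>D. 1/2 * (norm (p - x))\<^sup>2 + gr p \<le> 1/2 * (norm (w - x))\<^sup>2 + gr w"
proof -
  obtain z0 where z0: "z0 \<in> D" using D_nonempty by blast
  have ex: "\<exists>u\<in>cball z0 R \<inter> D. \<forall>z\<in>cball z0 R \<inter> D. c u + gr u \<le> c z + gr z"
    if "R \<ge> 0" "continuous_on UNIV c" for R and c :: "'a \<Rightarrow> real"
  proof (rule lsc_plus_continuous_attains_min[OF g_lsc g_not_MInf])
    show "continuous_on (cball z0 R) c" using that(2) by (rule continuous_on_subset) simp
    have "z0 \<in> cball z0 R \<inter> D" using z0 that(1) by simp
    then show "cball z0 R \<inter> D \<noteq> {}" by blast
  qed simp
  obtain m where m: "m \<in> cball z0 1 \<inter> D" "\<And>z. z \<in> cball z0 1 \<inter> D \<Longrightarrow> gr m \<le> gr z"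
    using ex[of 1 "\<lambda>_. 0"] by auto
  define a where "a = norm (x - z0)"
  define b where "b = gr z0 - gr m"
  have b: "b \<ge> 0" using m(2)[of z0] z0 by (simp add: b_def)
  \<comment> \<open>At distance \<open>n\<close> from \<open>z0\<close> the quadratic gains \<open>n (n - 2 a) / 2\<close> and \<open>g\<close> loses at most \<open>n b\<close>.\<close>
  define R where "R = max 1 (2 * a + 2 * b)"
  have R: "R \<ge> 1" "R \<ge> 2 * a + 2 * b" by (auto simp: R_def)
  have "continuous_on UNIV (\<lambda>z. 1/2 * (norm (z - x))\<^sup>2)" by (intro continuous_intros)
  then obtain p where p: "p \<in> cball z0 R \<inter> D"
    "\<And>z. z \<in> cball z0 R \<inter> D \<Longrightarrow> 1/2 * (norm (p - x))\<^sup>2 + gr p \<le> 1/2 * (norm (z - x))\<^sup>2 + gr z"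
    using ex[of R "\<lambda>z. 1/2 * (norm (z - x))\<^sup>2"] R by auto
  have "1/2 * (norm (p - x))\<^sup>2 + gr p \<le> 1/2 * (norm (w - x))\<^sup>2 + gr w" if w: "w \<in> D" for w
  proof (cases "w \<in> cball z0 R")
    case True
    then show ?thesis using p w by blast
  next
    case False
    define n where "n = norm (w - z0)"
    have n: "n > R" using False by (simp add: n_def dist_norm norm_minus_commute)
    have n1: "0 < n" "1 / n \<le> 1" using n R by (auto simp: field_simps)
    have mem: "z0 + (1/n) *\<^sub>R (w - z0) \<in> cball z0 1"
      using n1 by (simp add: dist_norm n_def[symmetric] flip: n_def)
    have "gr m \<le> gr z0 + (1/n) * (gr w - gr z0)"
      using m(2)[of "z0 + (1/n) *\<^sub>R (w - z0)"] mem segment_point[OF z0 w, of "1/n"] n1 by fastforce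
    then have "n * gr m \<le> n * (gr z0 + (1/n) * (gr w - gr z0))" using n1 by (intro mult_left_mono) auto
    then have gw: "gr w \<ge> gr z0 - n * b" using n1 by (simp add: b_def algebra_simps)
    have na: "n - a \<le> norm (w - x)"
      using norm_triangle_ineq[of "w - x" "x - z0"] by (simp add: n_def a_def)
    have "0 \<le> n - a" using n R b a_def by (smt (verit) norm_ge_zero)
    then have "(n - a)\<^sup>2 \<le> (norm (w - x))\<^sup>2" using na by (intro power_mono) auto
    moreover have "n * (2 * a + 2 * b) \<le> n * n" using n R n1 by (intro mult_left_mono) auto
    ultimately have "1/2 * a\<^sup>2 + gr z0 \<le> 1/2 * (norm (w - x))\<^sup>2 + gr w"
      using gw by (simp add: power2_eq_square algebra_simps)
    moreover have "1/2 * (norm (p - x))\<^sup>2 + gr p \<le> 1/2 * a\<^sup>2 + gr z0"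
      using p(2)[of z0] z0 R by (simp add: a_def norm_minus_commute)
    ultimately show ?thesis by linarith
  qed
  then show ?thesis using p by blast
qed

lemma prox_minimizes:
  "prox g x \<in> D"
  "w \<in> D \<Longrightarrow> 1/2 * (norm (prox g x - x))\<^sup>2 + gr (prox g x) \<le> 1/2 * (norm (w - x))\<^sup>2 + gr w"
proof -
  let ?\<phi> = "\<lambda>z. ereal (1/2 * (norm (z - x))\<^sup>2) + g z"
  have \<phi>: "?\<phi> z = ereal (1/2 * (norm (z - x))\<^sup>2 + gr z)" if "z \<in> D" for z
    by (subst g_eq_ereal[OF that]) simp
  have inf: "?\<phi> z = \<infinity>" if "z \<notin> D" for z using that by (simp add: edom_def)
  obtain p where p: "p \<in> D" "\<And>w. w \<in> D \<Longrightarrow> 1/2 * (norm (p - x))\<^sup>2 + gr p \<le> 1/2 * (norm (w - x))\<^sup>2 + gr w"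
    using prox_objective_attained by blast
  have "?\<phi> p \<le> ?\<phi> y" for y
    using \<phi>[OF p(1)] p(2)[of y] \<phi>[of y] inf[of y] by (cases "y \<in> D") auto
  then have "is_arg_min ?\<phi> (\<lambda>_. True) p" by (auto simp: is_arg_min_def not_less)
  then have a: "is_arg_min ?\<phi> (\<lambda>_. True) (prox g x)"
    unfolding prox_def arg_min_def by (rule someI)
  then have le: "?\<phi> (prox g x) \<le> ?\<phi> y" for y by (auto simp: is_arg_min_def not_less)
  show m: "prox g x \<in> D"
    using le[of p] inf[of "prox g x"] \<phi>[OF p(1)] by (metis PInfty_neq_ereal(1) ereal_infty_less_eq(1))
  show "1/2 * (norm (prox g x - x))\<^sup>2 + gr (prox g x) \<le> 1/2 * (norm (w - x))\<^sup>2 + gr w" if "w \<in> D"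
    using le[of w] \<phi>[OF that] \<phi>[OF m] by simp
qed

text \<open>
  The optimality condition of the proximal problem, obtained by moving from the minimizer towards \<open>w\<close>.
\<close>

lemma subgradient_prox: "subgradient (prox g x) (x - prox g x)"
  unfolding subgradient_def
proof (intro conjI ballI)
  show "prox g x \<in> D" by (rule prox_minimizes)
  fix w assume w: "w \<in> D"
  let ?p = "prox g x"
  have "0 \<le> t * ((?p - x) \<bullet> (w - ?p) + (gr w - gr ?p)) + t^2 * (1/2 * (norm (w - ?p))\<^sup>2)"
    if t: "0 < t" "t < 1" for t
  proof -
    have s: "?p + t *\<^sub>R (w - ?p) \<in> D" "gr (?p + t *\<^sub>R (w - ?p)) \<le> gr ?p + t * (gr w - gr ?p)"
      using segment_point[OF prox_minimizes(1) w] t by auto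
    have "(norm (?p + t *\<^sub>R (w - ?p) - x))\<^sup>2
        = (norm (?p - x))\<^sup>2 + 2 * (t * ((?p - x) \<bullet> (w - ?p))) + t^2 * (norm (w - ?p))\<^sup>2"
      unfolding power2_norm_eq_inner by (simp add: inner_simps inner_commute power2_eq_square algebra_simps)
    then show ?thesis using prox_minimizes(2)[OF s(1), of x] s(2) by (simp add: algebra_simps)
  qed
  then have "0 \<le> (?p - x) \<bullet> (w - ?p) + (gr w - gr ?p)" by (rule nonneg_of_quadratic)
  then show "(x - ?p) \<bullet> (w - ?p) \<le> gr w - gr ?p" by (simp add: inner_diff_left)
qed

lemma subgradient_monotone:
  assumes "subgradient p v" "subgradient p' v'"
  shows "0 \<le> (v - v') \<bullet> (p - p')"
proof -
  have "v \<bullet> (p' - p) \<le> gr p' - gr p" "v' \<bullet> (p - p') \<le> gr p - gr p'"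
    using assms by (auto simp: subgradient_def)
  then show ?thesis by (simp add: inner_diff_left inner_diff_right)
qed

lemma prox_eqI:
  assumes "subgradient p (x - p)" shows "prox g x = p"
proof -
  have "0 \<le> ((x - p) - (x - prox g x)) \<bullet> (p - prox g x)"
    using subgradient_monotone[OF assms subgradient_prox] .
  then have "(p - prox g x) \<bullet> (p - prox g x) \<le> 0"
    by (simp add: inner_diff_left inner_diff_right inner_commute)
  then have "p - prox g x = 0" by (metis inner_ge_zero inner_eq_zero_iff order_antisym)
  then show ?thesis by simp
qed

lemma prox_nonexpansive: "norm (prox g x - prox g z) \<le> norm (x - z)"
proof -
  let ?p = "prox g x" and ?r = "prox g z"
  have "0 \<le> ((x - ?p) - (z - ?r)) \<bullet> (?p - ?r)" by (rule subgradient_monotone[OF subgradient_prox subgradient_prox])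
  then have "(norm (?p - ?r))\<^sup>2 \<le> (x - z) \<bullet> (?p - ?r)"
    unfolding power2_norm_eq_inner by (simp add: inner_diff_left inner_diff_right inner_commute)
  also have "\<dots> \<le> norm (x - z) * norm (?p - ?r)" by (rule norm_cauchy_schwarz)
  finally show ?thesis
    by (cases "norm (?p - ?r) = 0") (auto simp: power2_eq_square)
qed

end

section \<open>Stationary points of a smooth plus a convex function\<close>

locale composite = lsc_convex g for g :: "'a::euclidean_space \<Rightarrow> ereal" +
  fixes f :: "'a \<Rightarrow> ereal" and U :: "'a set"
  assumes f_proper: "proper f" and f_C2: "C2_on f U" and closure_D: "closure (edom g) \<subseteq> U"
begin

abbreviation fr where "fr z \<equiv> real_of_ereal (f z)"
abbreviation Fr where "Fr z \<equiv> fr z + gr z"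
abbreviation df where "df \<equiv> egrad f"
abbreviation Hf where "Hf \<equiv> ehess f"
abbreviation r where "r \<equiv> residual f g"

lemma D_subset_U: "D \<subseteq> U" using closure_D closure_subset by blast

lemma f_eq_ereal: "z \<in> U \<Longrightarrow> f z = ereal (fr z)"
  using f_C2 by (auto simp: C2_on_def ereal_real)

lemma F_eq_ereal: "z \<in> D \<Longrightarrow> f z + g z = ereal (Fr z)"
  using f_eq_ereal[of z] g_eq_ereal[of z] D_subset_U by (metis plus_ereal.simps(1) subsetD)

lemma F_eq_PInfty: "z \<notin> D \<Longrightarrow> f z + g z = \<infinity>"
  using f_proper by (cases "f z") (auto simp: edom_def proper_def)

lemma F_finite_iff: "\<bar>f z + g z\<bar> \<noteq> \<infinity> \<longleftrightarrow> z \<in> D"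
  using F_eq_ereal[of z] F_eq_PInfty[of z] by (cases "z \<in> D") auto

lemma fr_has_derivative: "z \<in> U \<Longrightarrow> (fr has_derivative (\<lambda>h. h \<bullet> df z)) (at z)"
  using f_C2 GDERIV_grad[of fr z] by (auto simp: C2_on_def egrad_def gderiv_def)

lemma df_has_derivative: "z \<in> U \<Longrightarrow> (df has_derivative blinfun_apply (Hf z)) (at z)"
  using f_C2 hess_has_derivative[of fr z] by (auto simp: C2_on_def egrad_def ehess_def)

lemma isCont_fr: "z \<in> U \<Longrightarrow> isCont fr z"
  using fr_has_derivative has_derivative_continuous by blast

lemma isCont_df: "z \<in> U \<Longrightarrow> isCont df z"
  using df_has_derivative has_derivative_continuous by blast

text \<open>
  Along a segment in the domain the convex part lies below its chord, so that a lower bound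
  for the decrease of \<open>F\<close> passes to the derivative of \<open>f\<close> plus the chord slope of \<open>g\<close>. This one-sided
  comparison replaces a subdifferential sum rule.
\<close>

lemma ray_slope_bound:
  assumes u: "u \<in> D" and w: "w \<in> D"
    and lower: "\<forall>\<^sub>F t in at_right 0. - (t * m t) \<le> Fr (u + t *\<^sub>R (w - u)) - Fr u"
    and m: "(m \<longlongrightarrow> m0) (at_right 0)"
  shows "- m0 \<le> df u \<bullet> (w - u) + (gr w - gr u)"
proof -
  let ?q = "\<lambda>t::real. (fr (u + t *\<^sub>R (w - u)) - fr u) /\<^sub>R t"
  have uU: "u \<in> U" using u D_subset_U by blast
  have lim: "((\<lambda>t. ?q t + (gr w - gr u)) \<longlongrightarrow> (w - u) \<bullet> df u + (gr w - gr u)) (at_right 0)"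
    by (intro tendsto_add ray_quotient_tendsto[OF fr_has_derivative[OF uU]] tendsto_const)
  have "\<forall>\<^sub>F t::real in at_right 0. t < 1" by (rule eventually_at_right_field[THEN iffD2]) (auto intro: exI[of _ 1])
  with lower eventually_at_right_less have "\<forall>\<^sub>F t in at_right 0. - m t \<le> ?q t + (gr w - gr u)"
  proof eventually_elim
    case (elim t)
    have "gr (u + t *\<^sub>R (w - u)) \<le> gr u + t * (gr w - gr u)"
      using segment_point(2)[OF u w] elim by simp
    then have "t * (- m t) \<le> (fr (u + t *\<^sub>R (w - u)) - fr u) + t * (gr w - gr u)"
      using elim by simp
    also have "\<dots> = t * (?q t + (gr w - gr u))"
      using elim by (simp add: distrib_left mult.assoc[symmetric])
    finally show ?case using elim by (simp only: mult_le_cancel_left_pos)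
  qed
  then have "- m0 \<le> (w - u) \<bullet> df u + (gr w - gr u)"
    by (intro tendsto_le[OF _ lim tendsto_minus[OF m]]) auto
  then show ?thesis by (simp add: inner_commute)
qed

lemma regular_subdiff_imp_subgradient:
  assumes "v \<in> regular_subdiff (\<lambda>z. f z + g z) u"
  shows "subgradient u (v - df u)"
proof -
  have u: "u \<in> D" and li: "0 \<le> Liminf (at u) (\<lambda>z. (f z + g z - (f u + g u) - ereal (v \<bullet> (z - u))) / ereal (norm (z - u)))"
    using assms by (auto simp: regular_subdiff_def F_finite_iff)
  have "(v - df u) \<bullet> (w - u) \<le> gr w - gr u" if w: "w \<in> D" for w
  proof (cases "w = u")
    case False
    let ?n = "norm (w - u)"
    have n: "?n > 0" using False by simp
    have "v \<bullet> (w - u) \<le> df u \<bullet> (w - u) + (gr w - gr u)"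
    proof (rule field_le_epsilon)
      fix e :: real assume e: "e > 0"
      define e' where "e' = e / ?n"
      have e': "e' > 0" using e n by (simp add: e'_def)
      have "\<forall>\<^sub>F z in at u. ereal (- e') < (f z + g z - (f u + g u) - ereal (v \<bullet> (z - u))) / ereal (norm (z - u))"
        using li e' by (intro less_LiminfD) (auto intro: less_le_trans[of _ 0])
      moreover have "filterlim (\<lambda>t::real. u + t *\<^sub>R (w - u)) (at u) (at_right 0)"
      proof (rule filterlim_atI)
        have "((\<lambda>t::real. u + t *\<^sub>R (w - u)) \<longlongrightarrow> u + 0 *\<^sub>R (w - u)) (at_right 0)" by (intro tendsto_intros)
        then show "((\<lambda>t::real. u + t *\<^sub>R (w - u)) \<longlongrightarrow> u) (at_right 0)" by simp
        show "\<forall>\<^sub>F t in at_right (0::real). u + t *\<^sub>R (w - u) \<noteq> u"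
          using False by (intro eventually_mono[OF eventually_at_right_less[of "0::real"]]) auto
      qed
      ultimately have ev: "\<forall>\<^sub>F t in at_right 0. ereal (- e') <
          (f (u + t *\<^sub>R (w - u)) + g (u + t *\<^sub>R (w - u)) - (f u + g u) - ereal (v \<bullet> (u + t *\<^sub>R (w - u) - u)))
            / ereal (norm (u + t *\<^sub>R (w - u) - u))"
        by (rule eventually_compose_filterlim)
      have "\<forall>\<^sub>F t::real in at_right 0. t < 1" by (rule eventually_at_right_field[THEN iffD2]) (auto intro: exI[of _ 1])
      with ev eventually_at_right_less
      have "\<forall>\<^sub>F t in at_right 0. - (t * (e - v \<bullet> (w - u))) \<le> Fr (u + t *\<^sub>R (w - u)) - Fr u"
      proof eventually_elim
        case (elim t)
        have z: "u + t *\<^sub>R (w - u) \<in> D" using segment_point(1)[OF u w] elim by simp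
        have "- e' < (Fr (u + t *\<^sub>R (w - u)) - Fr u - t * (v \<bullet> (w - u))) / (t * ?n)"
          using elim False by (simp add: F_eq_ereal[OF z] F_eq_ereal[OF u])
        then have "- e' * (t * ?n) < Fr (u + t *\<^sub>R (w - u)) - Fr u - t * (v \<bullet> (w - u))"
          using elim n by (subst (asm) pos_less_divide_eq) auto
        moreover have "e' * (t * ?n) = t * e" using n by (simp add: e'_def)
        ultimately show ?case by (simp add: algebra_simps)
      qed
      from ray_slope_bound[OF u w this tendsto_const]
      show "v \<bullet> (w - u) \<le> df u \<bullet> (w - u) + (gr w - gr u) + e" by simp
    qed
    then show ?thesis by (simp add: inner_diff_left)
  qed simp
  then show ?thesis using u by (simp add: subgradient_def)
qed

text \<open>
  Together with the preceding lemma this is the sum rule \<open>\<partial>(f + g) = \<nabla>f + \<partial>g\<close> for regular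
  subgradients.
\<close>

lemma subgradient_imp_regular_subdiff:
  assumes p: "subgradient p v"
  shows "v + df p \<in> regular_subdiff (\<lambda>z. f z + g z) p"
proof -
  have pD: "p \<in> D" and sub: "\<And>w. w \<in> D \<Longrightarrow> v \<bullet> (w - p) \<le> gr w - gr p"
    using p by (auto simp: subgradient_def)
  have pU: "p \<in> U" using pD D_subset_U by blast
  let ?Q = "\<lambda>z. (f z + g z - (f p + g p) - ereal ((v + df p) \<bullet> (z - p))) / ereal (norm (z - p))"
  have "\<forall>\<^sub>F z in at p. y < ?Q z" if y: "y < 0" for y
  proof -
    obtain e where e: "e > 0" "y \<le> ereal (- e)"
    proof (cases y)
      case (real s)
      then show ?thesis using y that[of "- s"] by auto
    qed (use y that[of 1] in auto)
    have "\<forall>e>0. \<forall>\<^sub>F z in at p. norm (fr z - fr p - (z - p) \<bullet> df p) \<le> e * norm (z - p)"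
      using fr_has_derivative[OF pU] unfolding has_derivative_within_alt2 by (rule conjunct2)
    from this[rule_format, of "e/2"] e
    have "\<forall>\<^sub>F z in at p. norm (fr z - fr p - (z - p) \<bullet> df p) \<le> (e/2) * norm (z - p)" by simp
    moreover have "\<forall>\<^sub>F z in at p. z \<noteq> p" by (simp add: eventually_at_filter)
    ultimately show ?thesis
    proof eventually_elim
      case (elim z)
      have n: "norm (z - p) > 0" using elim by simp
      show ?case
      proof (cases "z \<in> D")
        case True
        have "(v + df p) \<bullet> (z - p) \<le> Fr z - Fr p + (e/2) * norm (z - p)"
          using sub[OF True] elim(1) unfolding inner_add_left inner_commute[of "z - p"] real_norm_def
          by linarith
        then have "- e * norm (z - p) < Fr z - Fr p - (v + df p) \<bullet> (z - p)"
          using mult_pos_pos[OF e(1) n] by (simp add: algebra_simps)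
        then have "- e < (Fr z - Fr p - (v + df p) \<bullet> (z - p)) / norm (z - p)"
          using n by (subst pos_less_divide_eq) auto
        then have "ereal (- e) < ?Q z" using elim by (simp add: F_eq_ereal[OF True] F_eq_ereal[OF pD])
        then show ?thesis using e(2) by (rule le_less_trans[rotated])
      next
        case False
        have "?Q z = \<infinity>" using elim by (simp add: F_eq_PInfty[OF False] F_eq_ereal[OF pD])
        then show ?thesis using y by (metis ereal_infty_less(1) less_ereal.simps(4) not_less_iff_gr_or_eq zero_ereal_def less_trans ereal_less(5) MInfty_neq_PInfty(1))
      qed
    qed
  qed
  then have "0 \<le> Liminf (at p) ?Q" by (simp add: le_Liminf_iff)
  then show ?thesis using pD F_finite_iff by (simp add: regular_subdiff_def)
qed

lemma regular_subset_limiting: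
  "regular_subdiff h p \<subseteq> limiting_subdiff h p"
proof
  fix v assume v: "v \<in> regular_subdiff h p"
  then have "\<bar>h p\<bar> \<noteq> \<infinity>" by (simp add: regular_subdiff_def)
  then show "v \<in> limiting_subdiff h p" unfolding limiting_subdiff_def
    using v by (intro CollectI conjI exI[of _ "\<lambda>_. p"] exI[of _ "\<lambda>_. v"]) auto
qed

text \<open>
  In passing to the limit in the subgradient inequalities it is the convergence of the values
  \<open>F (u n)\<close>, built into the limiting subdifferential, that makes \<open>gr (u n)\<close> converge.
\<close>

lemma stationary_iff: "p \<in> stationary f g \<longleftrightarrow> subgradient p (- df p)"
proof
  assume "subgradient p (- df p)"
  then have "- df p + df p \<in> limiting_subdiff (\<lambda>z. f z + g z) p"
    using subgradient_imp_regular_subdiff regular_subset_limiting by blast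
  then show "p \<in> stationary f g" by (simp add: stationary_def)
next
  assume "p \<in> stationary f g"
  then obtain u w where p: "\<bar>f p + g p\<bar> \<noteq> \<infinity>" and u: "u \<longlonglongrightarrow> p"
    and Fu: "(\<lambda>n. f (u n) + g (u n)) \<longlonglongrightarrow> f p + g p"
    and w: "\<And>n. w n \<in> regular_subdiff (\<lambda>z. f z + g z) (u n)" "w \<longlonglongrightarrow> 0"
    by (auto simp: stationary_def limiting_subdiff_def)
  have pD: "p \<in> D" using p F_finite_iff by simp
  have pU: "p \<in> U" using pD D_subset_U by blast
  have sub: "subgradient (u n) (w n - df (u n))" for n
    using regular_subdiff_imp_subgradient w by blast
  have uD: "u n \<in> D" for n using sub by (simp add: subgradient_def)
  have "(\<lambda>n. ereal (Fr (u n))) \<longlonglongrightarrow> ereal (Fr p)" using Fu F_eq_ereal uD pD by simp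
  then have "(\<lambda>n. Fr (u n)) \<longlonglongrightarrow> Fr p" by simp
  moreover have "(\<lambda>n. fr (u n)) \<longlonglongrightarrow> fr p" using isCont_fr[OF pU] u by (rule isCont_tendsto_compose)
  ultimately have "(\<lambda>n. Fr (u n) - fr (u n)) \<longlonglongrightarrow> Fr p - fr p" by (rule tendsto_diff)
  then have g: "(\<lambda>n. gr (u n)) \<longlonglongrightarrow> gr p" by simp
  have d: "(\<lambda>n. df (u n)) \<longlonglongrightarrow> df p" using isCont_df[OF pU] u by (rule isCont_tendsto_compose)
  have "- df p \<bullet> (z - p) \<le> gr z - gr p" if z: "z \<in> D" for z
  proof -
    have 1: "(\<lambda>n. (w n - df (u n)) \<bullet> (z - u n)) \<longlonglongrightarrow> (0 - df p) \<bullet> (z - p)"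
      by (intro tendsto_intros w d u)
    have 2: "(\<lambda>n. gr z - gr (u n)) \<longlonglongrightarrow> gr z - gr p" by (intro tendsto_intros g)
    have "(w n - df (u n)) \<bullet> (z - u n) \<le> gr z - gr (u n)" for n
      using sub[of n] z by (simp add: subgradient_def)
    then have "(0 - df p) \<bullet> (z - p) \<le> gr z - gr p" by (intro LIMSEQ_le[OF 1 2]) blast
    then show ?thesis by simp
  qed
  then show "subgradient p (- df p)" using pD by (simp add: subgradient_def)
qed

section \<open>The residual\<close>

lemma residual_zero_imp_stationary:
  assumes "r z = 0" shows "z \<in> stationary f g"
proof -
  have "z = prox g (z - df z)" using assms by (simp add: residual_def)
  then have "subgradient z (z - df z - z)" using subgradient_prox by metis
  then show ?thesis by (simp add: stationary_iff)
qed

lemma residual_nonneg: "0 \<le> r z" by (simp add: residual_def)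

lemma residual_diff: "\<bar>r y - r z\<bar> \<le> 2 * norm (y - z) + norm (df y - df z)"
proof -
  have "norm (prox g (y - df y) - prox g (z - df z)) \<le> norm (y - z) + norm (df y - df z)"
    using prox_nonexpansive[of "y - df y" "z - df z"] norm_triangle_ineq4[of "y - z" "df y - df z"]
    by (simp add: algebra_simps)
  moreover have "\<bar>r y - r z\<bar> \<le> norm ((y - prox g (y - df y)) - (z - prox g (z - df z)))"
    unfolding residual_def by (rule norm_triangle_ineq3)
  moreover have "norm ((y - prox g (y - df y)) - (z - prox g (z - df z)))
      \<le> norm (y - z) + norm (prox g (y - df y) - prox g (z - df z))"
    using norm_triangle_ineq4[of "y - z" "prox g (y - df y) - prox g (z - df z)"] by (simp add: algebra_simps)
  ultimately show ?thesis by linarith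
qed

text \<open>
  If \<open>F + a \<cdot> dist\<^sup>p\<close> decreases at most at rate \<open>m\<close> around \<open>u\<close>, then the residual at \<open>u\<close> is small. Moving
  from \<open>u\<close> towards its proximal-gradient point lowers \<open>F\<close> at the rate \<open>r u\<close> per unit
  length, while the distance to \<open>S\<close>, being 1-Lipschitz, raises the other term at rate at most
  \<open>a p dist\<^sup>p\<^sup>-\<^sup>1\<close>.
\<close>

lemma residual_le_slope:
  assumes u: "u \<in> D" and a: "0 \<le> a" and p: "1 \<le> p" and S: "0 < infdist u S" and e: "0 < e"
    and min: "\<And>z. z \<in> D \<Longrightarrow> norm (z - u) < e \<Longrightarrow>
      Fr u + a * infdist u S powr p \<le> Fr z + a * infdist z S powr p + m * norm (z - u)"
  shows "r u \<le> a * p * infdist u S powr (p - 1) + m \<or> r u = 0"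
proof -
  let ?w = "prox g (u - df u)" and ?d = "infdist u S"
  let ?R = "norm (?w - u)"
  have w: "?w \<in> D" by (rule prox_minimizes)
  have R: "r u = ?R" by (simp add: residual_def norm_minus_commute)
  have "(u - df u - ?w) \<bullet> (u - ?w) \<le> gr u - gr ?w"
    using subgradient_prox u by (simp add: subgradient_def)
  then have model: "df u \<bullet> (?w - u) + (gr ?w - gr u) \<le> - (?R * ?R)"
    by (simp add: inner_diff_left inner_diff_right inner_commute power2_eq_square[symmetric] power2_norm_eq_inner)
  have pow: "((\<lambda>t. ((?d + t * ?R) powr p - ?d powr p) /\<^sub>R t) \<longlongrightarrow> ?R * (p * ?d powr (p - 1))) (at_right 0)"
  proof -
    have "((\<lambda>s. s powr p) has_real_derivative p * ?d powr (p - 1)) (at ?d)"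
      using S by (auto intro!: derivative_eq_intros simp: powr_diff)
    then have "((\<lambda>s. s powr p) has_derivative (*) (p * ?d powr (p - 1))) (at ?d)"
      by (simp add: has_field_derivative_def)
    from ray_quotient_tendsto[OF this, of ?R] show ?thesis by (simp add: mult.commute)
  qed
  let ?m = "\<lambda>t. m * ?R + a * (((?d + t * ?R) powr p - ?d powr p) /\<^sub>R t)"
  have "\<forall>\<^sub>F t::real in at_right 0. t < min 1 (e / (?R + 1))"
    unfolding eventually_at_right_field using e
    by (intro exI[of _ "min 1 (e / (?R + 1))"]) (auto simp: add_nonneg_pos)
  with eventually_at_right_less
  have "\<forall>\<^sub>F t in at_right 0. - (t * ?m t) \<le> Fr (u + t *\<^sub>R (?w - u)) - Fr u"
  proof eventually_elim
    case (elim t)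
    let ?z = "u + t *\<^sub>R (?w - u)"
    have t: "0 < t" "t \<le> 1" "t * (?R + 1) < e"
      using elim by (auto simp: pos_less_divide_eq add_nonneg_pos)
    have z: "?z \<in> D" using segment_point(1)[OF u w] t by simp
    have nz: "norm (?z - u) = t * ?R" using t by simp
    have "norm (?z - u) < e" unfolding nz using t by (simp add: algebra_simps)
    from min[OF z this]
    have "Fr u + a * ?d powr p \<le> Fr ?z + a * infdist ?z S powr p + m * (t * ?R)" by (simp only: nz)
    moreover have "a * infdist ?z S powr p \<le> a * (?d + t * ?R) powr p"
    proof -
      have "infdist ?z S \<le> ?d + t * ?R" using infdist_triangle[of ?z S u] nz by (simp only: dist_norm)
      then show ?thesis using p a by (intro mult_left_mono powr_mono2) (auto simp: infdist_nonneg)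
    qed
    moreover have "t * ?m t = m * (t * ?R) + a * ((?d + t * ?R) powr p - ?d powr p)"
      using t by (simp add: distrib_left mult_ac)
    ultimately show ?case unfolding right_diff_distrib by linarith
  qed
  moreover have "(?m \<longlongrightarrow> m * ?R + a * (?R * (p * ?d powr (p - 1)))) (at_right 0)"
    by (intro tendsto_intros pow)
  ultimately have "?R * ?R \<le> m * ?R + a * (?R * (p * ?d powr (p - 1)))"
    using ray_slope_bound[OF u w] model by (meson neg_le_iff_le order_trans)
  then have "?R * ?R \<le> (a * p * ?d powr (p - 1) + m) * ?R" by (simp add: algebra_simps)
  then show ?thesis unfolding R by (cases "?R = 0") (auto simp: mult_le_cancel_right)
qed

end

section \<open>Growth from an error bound\<close>

context composite
begin

text \<open>
  Suppose the improved bound fails at \<open>x0\<close>. Then \<open>G = F + a \<cdot> dist\<^sup>p\<close>, which is at least \<open>Fb\<close>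
  nearby, is nearly minimal at \<open>x0\<close>. As in Ekeland's principle, minimizing \<open>G + e \<parallel>\<cdot> - x0\<parallel>\<close> on the ball
  with radius half the distance \<open>d\<close> of \<open>x0\<close> to \<open>S\<close> gives an interior point \<open>u\<close> where \<open>G\<close> has slope at
  most \<open>e\<close>. Its residual is then too small for the error bound, because \<open>u\<close> is still at distance more
  than \<open>d / 2\<close> from \<open>S\<close> and \<open>a p \<le> k < K\<close>.
\<close>

lemma growth_improvement:
  assumes sub: "cball xb R \<subseteq> U" and R: "0 < R" and xb: "infdist xb S = 0" and p: "1 < p"
    and a: "0 \<le> a" "a * p \<le> k" "k < K"
    and err: "\<And>z. z \<in> D \<Longrightarrow> norm (z - xb) \<le> R \<Longrightarrow> K * infdist z S powr (p - 1) \<le> r z"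
    and low: "\<And>z. z \<in> D \<Longrightarrow> norm (z - xb) \<le> R \<Longrightarrow> Fb - a * infdist z S powr p \<le> Fr z"
    and x0: "x0 \<in> D" "norm (x0 - xb) \<le> R / 2"
  shows "Fb - (a - (K - k) / (2 * 2 powr p)) * infdist x0 S powr p \<le> Fr x0"
proof (cases "infdist x0 S = 0")
  case True
  then show ?thesis using low[OF x0(1)] x0 R p by simp
next
  case False
  define \<delta> where "\<delta> = (K - k) / (2 * 2 powr p)"
  have \<delta>: "0 < \<delta>" using a by (simp add: \<delta>_def)
  define d where "d = infdist x0 S"
  have d: "0 < d" using False infdist_nonneg[of x0 S] by (simp add: d_def)
  have dR: "d \<le> R / 2"
    using infdist_triangle[of x0 S xb] xb x0 by (simp add: d_def dist_norm)
  show ?thesis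
  proof (rule ccontr)
    assume "\<not> ?thesis"
    then have less: "Fr x0 < Fb - a * d powr p + \<delta> * d powr p" by (simp add: \<delta>_def d_def algebra_simps)
    \<comment> \<open>The penalty at the boundary of the ball, \<open>e d / 2\<close>, equals the largest possible gain of \<open>G\<close>.\<close>
    define e where "e = 2 * \<delta> * d powr (p - 1)"
    have e: "0 < e" using \<delta> d by (simp add: e_def)
    have ed: "e * (d / 2) = \<delta> * d powr p"
      using d powr_add[of d "p - 1" 1] by (simp add: e_def)
    let ?c = "\<lambda>z. fr z + a * infdist z S powr p + e * norm (z - x0)"
    have ball: "norm (z - xb) \<le> R" if "z \<in> cball x0 (d / 2)" for z
    proof -
      have "norm (z - x0) \<le> d / 2" using that by (simp add: dist_norm norm_minus_commute)
      then show ?thesis using norm_triangle_ineq[of "z - x0" "x0 - xb"] x0 dR R by simp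
    qed
    then have subU: "cball x0 (d / 2) \<subseteq> U" using sub by (auto simp: dist_norm norm_minus_commute)
    have "\<exists>u\<in>cball x0 (d / 2) \<inter> D. \<forall>z\<in>cball x0 (d / 2) \<inter> D. ?c u + gr u \<le> ?c z + gr z"
    proof (rule lsc_plus_continuous_attains_min[OF g_lsc g_not_MInf])
      have "continuous_on (cball x0 (d / 2)) fr"
        using isCont_fr subU by (auto intro!: continuous_at_imp_continuous_on)
      then show "continuous_on (cball x0 (d / 2)) ?c"
        using p by (intro continuous_intros continuous_on_powr') (auto simp: infdist_nonneg)
      have "x0 \<in> cball x0 (d / 2) \<inter> D" using x0 d by simp
      then show "cball x0 (d / 2) \<inter> D \<noteq> {}" by blast
    qed simp
    then obtain u where u: "u \<in> cball x0 (d / 2)" "u \<in> D"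
      and min: "\<And>z. z \<in> cball x0 (d / 2) \<Longrightarrow> z \<in> D \<Longrightarrow> ?c u + gr u \<le> ?c z + gr z" by blast
    have "?c u + gr u \<le> ?c x0 + gr x0" using min[of x0] x0 d by simp
    then have "e * norm (u - x0) < e * (d / 2)"
      using low[OF u(2) ball[OF u(1)]] less ed by (simp add: d_def)
    then have un: "norm (u - x0) < d / 2" using e by (simp only: mult_less_cancel_left_pos)
    define du where "du = infdist u S"
    have du: "d / 2 < du"
      using infdist_triangle[of x0 S u] un by (simp add: d_def du_def dist_norm norm_minus_commute)
    have "r u \<le> a * p * infdist u S powr (p - 1) + e \<or> r u = 0"
    proof (rule residual_le_slope[OF u(2) a(1), where e = "d / 2 - norm (u - x0)"])
      fix z assume z: "z \<in> D" "norm (z - u) < d / 2 - norm (u - x0)"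
      have zx: "norm (z - x0) \<le> norm (z - u) + norm (u - x0)"
        using norm_triangle_ineq[of "z - u" "u - x0"] by simp
      then have "z \<in> cball x0 (d / 2)" using z by (simp add: dist_norm norm_minus_commute)
      moreover have "e * norm (z - x0) \<le> e * norm (z - u) + e * norm (u - x0)"
        using zx e by (simp flip: distrib_left)
      ultimately show "Fr u + a * infdist u S powr p \<le> Fr z + a * infdist z S powr p + e * norm (z - u)"
        using min[OF _ z(1)] by fastforce
    qed (use p du d un in \<open>auto simp: du_def\<close>)
    moreover have pos: "0 < du powr (p - 1)" using du d by simp
    have "0 \<le> k" using a p by (smt (verit) mult_nonneg_nonneg)
    then have "0 < K * du powr (p - 1)" using a(3) pos by simp
    moreover have "K * du powr (p - 1) \<le> r u" using err[OF u(2) ball[OF u(1)]] by (simp add: du_def)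
    ultimately have 1: "K * du powr (p - 1) \<le> a * p * du powr (p - 1) + e" by (auto simp: du_def)
    have "(d / 2) powr (p - 1) \<le> du powr (p - 1)" using du d p by (intro powr_mono2) auto
    then have "d powr (p - 1) \<le> 2 powr (p - 1) * du powr (p - 1)"
      using d by (simp add: powr_divide field_simps)
    then have "e \<le> 2 * \<delta> * (2 powr (p - 1) * du powr (p - 1))"
      unfolding e_def using \<delta> by (intro mult_left_mono) auto
    also have "\<dots> = \<delta> * 2 powr p * du powr (p - 1)" using powr_add[of 2 "p - 1" 1] by simp
    also have "\<dots> = (K - k) / 2 * du powr (p - 1)" by (simp add: \<delta>_def)
    finally have "K * du powr (p - 1) \<le> (a * p + (K - k) / 2) * du powr (p - 1)"
      using 1 unfolding distrib_right by linarith
    then have "K \<le> a * p + (K - k) / 2" using pos by (simp only: mult_le_cancel_right_pos)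
    then show False using a by (simp add: field_simps)
  qed
qed

text \<open>
  Each improvement step lowers \<open>a\<close> by the same amount at the price of halving the ball, so after
  finitely many steps the coefficient is negative, which is genuine growth.
\<close>

lemma error_bound_imp_growth:
  assumes sub: "cball xb R \<subseteq> U" and R: "0 < R" and xb: "infdist xb S = 0" and p: "1 < p"
    and a: "0 \<le> a" "a * p \<le> k" "k < K"
    and err: "\<And>z. z \<in> D \<Longrightarrow> norm (z - xb) \<le> R \<Longrightarrow> K * infdist z S powr (p - 1) \<le> r z"
    and low: "\<And>z. z \<in> D \<Longrightarrow> norm (z - xb) \<le> R \<Longrightarrow> Fb - a * infdist z S powr p \<le> Fr z"
  shows "\<exists>c>0. \<exists>R'>0. \<forall>z\<in>D. norm (z - xb) \<le> R' \<longrightarrow> Fb + c * infdist z S powr p \<le> Fr z"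
proof (rule ccontr)
  assume no: "\<not> ?thesis"
  define \<delta> where "\<delta> = (K - k) / (2 * 2 powr p)"
  have \<delta>: "0 < \<delta>" using a by (simp add: \<delta>_def)
  have "0 \<le> a - real n * \<delta> \<and> (\<exists>R'>0. R' \<le> R \<and>
      (\<forall>z\<in>D. norm (z - xb) \<le> R' \<longrightarrow> Fb - (a - real n * \<delta>) * infdist z S powr p \<le> Fr z))" for n
  proof (induction n)
    case 0
    then show ?case using a low R by auto
  next
    case (Suc n)
    then obtain R' where R': "R' > 0" "R' \<le> R"
      "\<And>z. z \<in> D \<Longrightarrow> norm (z - xb) \<le> R' \<Longrightarrow> Fb - (a - real n * \<delta>) * infdist z S powr p \<le> Fr z"
      and nn: "0 \<le> a - real n * \<delta>" by blast
    have "(a - real n * \<delta>) * p \<le> a * p" using p \<delta> by (intro mult_right_mono) auto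
    then have ap: "(a - real n * \<delta>) * p \<le> k" using a by linarith
    have step: "Fb - (a - real (Suc n) * \<delta>) * infdist z S powr p \<le> Fr z"
      if "z \<in> D" "norm (z - xb) \<le> R' / 2" for z
    proof -
      have "cball xb R' \<subseteq> U" using sub R' by auto
      from growth_improvement[OF this R'(1) xb p nn ap a(3) _ _ that]
      have "Fb - (a - real n * \<delta> - \<delta>) * infdist z S powr p \<le> Fr z"
        unfolding \<delta>_def[symmetric] using R' err by auto
      moreover have "a - real n * \<delta> - \<delta> = a - real (Suc n) * \<delta>" by (simp add: algebra_simps)
      ultimately show ?thesis by simp
    qed
    have "0 \<le> a - real (Suc n) * \<delta>"
    proof (rule ccontr)
      assume "\<not> 0 \<le> a - real (Suc n) * \<delta>"
      then have "0 < - (a - real (Suc n) * \<delta>)" by simp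
      moreover have "0 < R' / 2" using R' by simp
      ultimately show False using no step by (metis (no_types, opaque_lifting) diff_conv_add_uminus mult_minus_left)
    qed
    then show ?case using step R' by (intro conjI exI[of _ "R' / 2"]) auto
  qed
  moreover obtain n where "a < real n * \<delta>" using reals_Archimedean3[OF \<delta>] by blast
  ultimately show False by (smt (verit))
qed

section \<open>Values at stationary points under the Kurdyka--Lojasiewicz property\<close>

text \<open>
  At a stationary point the Kurdyka--Lojasiewicz inequality would read \<open>0 \<ge> 1\<close>, so its value cannot lie
  in the window just above \<open>F(xb)\<close>. That the values of stationary points close to \<open>xb\<close> do not
  exceed this window follows from the subgradient inequality of \<open>g\<close> at \<open>p\<close>, tested at \<open>xb\<close>.
\<close>

lemma KL_stationary_value:
  assumes KL: "KL_at (\<lambda>z. f z + g z) xb" and xb: "xb \<in> D"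
  shows "\<exists>e>0. \<forall>p\<in>stationary f g. norm (p - xb) < e \<longrightarrow> Fr p \<le> Fr xb"
proof -
  obtain \<delta> w \<phi> where \<delta>: "\<delta> > 0" and w: "w > 0"
    and ineq: "\<And>x. x \<in> cball xb \<delta> \<Longrightarrow> f xb + g xb < f x + g x \<Longrightarrow> f x + g x < f xb + g xb + w \<Longrightarrow>
      ereal (deriv \<phi> (real_of_ereal (f x + g x - (f xb + g xb)))) * edist_set 0 (limiting_subdiff (\<lambda>z. f z + g z) x) \<ge> 1"
    using KL unfolding KL_at_def by blast
  obtain w0 where w0: "w0 > 0" "ereal w0 < w" using w by (metis ereal_dense2 ereal_less(2) zero_ereal_def)
  have xbU: "xb \<in> U" using xb D_subset_U by blast
  have "(fr \<longlongrightarrow> fr xb) (nhds xb)" "(df \<longlongrightarrow> df xb) (nhds xb)"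
    using isCont_fr[OF xbU] isCont_df[OF xbU] tendsto_at_iff_tendsto_nhds[of fr xb]
      tendsto_at_iff_tendsto_nhds[of df xb] by (simp_all only: isCont_def)
  then have "((\<lambda>p. fr p + df p \<bullet> (xb - p)) \<longlongrightarrow> fr xb + df xb \<bullet> (xb - xb)) (nhds xb)"
    by (intro tendsto_add tendsto_inner tendsto_diff tendsto_const filterlim_ident)
  then have "\<forall>\<^sub>F p in nhds xb. fr p + df p \<bullet> (xb - p) < fr xb + w0"
    using w0 by (intro order_tendstoD(2)) auto
  then obtain e where e: "e > 0" "\<And>p. dist p xb < e \<Longrightarrow> fr p + df p \<bullet> (xb - p) < fr xb + w0"
    unfolding eventually_nhds_metric by blast
  have "Fr p \<le> Fr xb" if p: "p \<in> stationary f g" "norm (p - xb) < min \<delta> e" for p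
  proof (rule ccontr)
    assume gt: "\<not> Fr p \<le> Fr xb"
    have sub: "subgradient p (- df p)" using p by (simp add: stationary_iff)
    then have pD: "p \<in> D" by (simp add: subgradient_def)
    have "- df p \<bullet> (xb - p) \<le> gr xb - gr p" using sub xb by (simp add: subgradient_def)
    then have "Fr p < Fr xb + w0" using e(2)[of p] p by (simp add: dist_norm)
    then have "f p + g p < f xb + g xb + ereal w0" by (simp add: F_eq_ereal[OF pD] F_eq_ereal[OF xb])
    also have "\<dots> \<le> f xb + g xb + w" using w0 by (intro add_left_mono) auto
    finally have 1: "f p + g p < f xb + g xb + w" .
    have 2: "f xb + g xb < f p + g p" using gt by (simp add: F_eq_ereal[OF pD] F_eq_ereal[OF xb])
    have 0: "0 \<in> limiting_subdiff (\<lambda>z. f z + g z) p" using p by (simp add: stationary_def)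
    then have "edist_set 0 (limiting_subdiff (\<lambda>z. f z + g z) p) = 0"
      by (auto simp: edist_set_def)
    then show False using ineq[OF _ 2 1] p by (simp add: dist_norm norm_minus_commute)
  qed
  then show ?thesis using \<delta> e by (intro exI[of _ "min \<delta> e"]) auto
qed

end

section \<open>One step of the regularized Newton method\<close>

lemma powr_minus_one_mult: "0 \<le> t \<Longrightarrow> t * t powr (q - 1) = (t::real) powr q"
  by (cases "t = 0") (simp_all add: powr_diff)

text \<open>
  The arithmetic behind the step length estimate, for the step length \<open>t\<close>, the norm \<open>n\<close> of the inexactness
  vector, the distance \<open>d\<close> to the reference point \<open>p\<close> and \<open>a = \<parallel>z - p\<parallel>\<close>. If \<open>n\<close> and \<open>d\<close> are at most
  \<open>\<theta> t\<close>, the two sides of \<open>main\<close> are \<open>L t\<^sup>q\<close> and \<open>\<rho> A L t\<^sup>q\<close> up to relative errors of order \<open>\<theta>\<close>, plus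
  terms \<open>O(\<theta> t\<^sup>3)\<close>, which \<open>q \<le> 3\<close> and \<open>t \<le> 1\<close> make \<open>O(\<theta> t\<^sup>q)\<close>. Since \<open>\<rho> A < 1\<close>, this is impossible for
  small \<open>\<theta>\<close>.
\<close>

lemma step_length_contradiction:
  fixes t n d a L s q :: real
  assumes q: "2 < q" "q \<le> 3" and t: "0 < t" "t \<le> 1" and n: "0 \<le> n" "n \<le> \<rho> * L * t powr (q - 1)" "n \<le> \<theta> * t"
    and d: "0 \<le> d" "d < \<theta> * t" and a: "0 \<le> a" "a \<le> t + n + d"
    and L: "0 < Lm" "Lm \<le> L" and c: "0 < A" "0 < \<rho>" "\<rho> * A < 1" and B: "0 < B"
    and \<theta>: "0 < \<theta>" "\<theta> \<le> (1 - \<rho> * A) / 8" "24 * B * \<theta> < Lm * (1 - \<rho> * A)"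
    and main: "L * t powr (q - 1) * (t - n - d) \<le> a * (A * n + B * d\<^sup>2 + B * d * a)"
  shows False
proof -
  let ?s = "t powr (q - 1)"
  have "0 < \<rho> * A" using c by simp
  moreover have "8 * \<theta> \<le> 1 - \<rho> * A" using \<theta>(2) by simp
  ultimately have \<theta>1: "\<theta> \<le> 1" by linarith
  then have \<theta>t: "\<theta> * t \<le> t" using t by simp
  have s: "0 < ?s" "t\<^sup>2 \<le> ?s"
    using t q powr_mono'[of "q - 1" 2 t] by auto
  have dt: "d \<le> t" using d \<theta>t by linarith
  have nt: "n \<le> t" using n \<theta>t by linarith
  have a1: "a \<le> (1 + 2 * \<theta>) * t" using a n d by (simp add: algebra_simps)
  have a3: "a \<le> 3 * t" using a dt nt by simp
  have L0: "0 < L" using L by simp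
  have "L * ?s * ((1 - 2 * \<theta>) * t) \<le> L * ?s * (t - n - d)"
    using n d s L0 by (intro mult_left_mono) (auto simp: algebra_simps)
  moreover have "a * (A * n) \<le> ((1 + 2 * \<theta>) * t) * (A * (\<rho> * L * ?s))"
    using a a1 n c t \<theta> by (intro mult_mono mult_left_mono) auto
  moreover have "a * (B * d\<^sup>2 + B * d * a) \<le> (3 * t) * (4 * B * \<theta> * ?s)"
  proof (rule mult_mono[OF a3])
    have "d\<^sup>2 \<le> (\<theta> * t) * t" unfolding power2_eq_square using d dt by (intro mult_mono) auto
    moreover have "d * a \<le> (\<theta> * t) * (3 * t)" using d a3 a t \<theta> by (intro mult_mono) auto
    ultimately have "d\<^sup>2 + d * a \<le> 4 * \<theta> * t\<^sup>2" by (simp add: power2_eq_square)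
    also have "\<dots> \<le> 4 * \<theta> * ?s" using s \<theta> by (intro mult_left_mono) auto
    finally have "B * (d\<^sup>2 + d * a) \<le> B * (4 * \<theta> * ?s)" using B by (intro mult_left_mono) auto
    then show "B * d\<^sup>2 + B * d * a \<le> 4 * B * \<theta> * ?s" by (simp add: algebra_simps)
  qed (use t B d a in auto)
  ultimately have "L * ?s * ((1 - 2 * \<theta>) * t) \<le> ((1 + 2 * \<theta>) * t) * (A * (\<rho> * L * ?s)) + (3 * t) * (4 * B * \<theta> * ?s)"
    using main by (simp add: algebra_simps)
  then have "(L * (1 - 2 * \<theta> - (1 + 2 * \<theta>) * (\<rho> * A))) * (?s * t) \<le> (12 * B * \<theta>) * (?s * t)"
    by (simp add: algebra_simps)
  then have 1: "L * (1 - 2 * \<theta> - (1 + 2 * \<theta>) * (\<rho> * A)) \<le> 12 * B * \<theta>"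
    using s t by (subst (asm) mult_le_cancel_right_pos) auto
  have "\<theta> * (\<rho> * A) \<le> \<theta> * 1" using \<theta> c by (intro mult_left_mono) auto
  then have "(1 - \<rho> * A) / 2 \<le> 1 - 2 * \<theta> - (1 + 2 * \<theta>) * (\<rho> * A)"
  proof -
    have arith: "(1 - u) / 2 \<le> 1 - 2 * \<theta> - (u + 2 * w)" if "8 * \<theta> \<le> 1 - u" "w \<le> \<theta>" for u w :: real
      using that by simp
    have "8 * \<theta> \<le> 1 - \<rho> * A" using \<theta>(2) by simp
    moreover have "(1 + 2 * \<theta>) * (\<rho> * A) = \<rho> * A + 2 * (\<theta> * (\<rho> * A))" by (simp add: algebra_simps)
    ultimately show ?thesis using arith \<open>\<theta> * (\<rho> * A) \<le> \<theta> * 1\<close> by (metis mult.right_neutral)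
  qed
  then have "Lm * ((1 - \<rho> * A) / 2) \<le> L * (1 - 2 * \<theta> - (1 + 2 * \<theta>) * (\<rho> * A))"
    using L c by (intro mult_mono) auto
  then show False using 1 \<theta>(3) by simp
qed

text \<open>
  The condition \<open>\<rho> * (1 + Lg) < 1\<close> keeps the inexactness vector, together with its image under the
  Hessian, below the regularization term when the two meet in a monotonicity inequality.
\<close>

locale regularized_newton = composite g f U
  for g f :: "'a::euclidean_space \<Rightarrow> ereal" and U :: "'a set" +
  fixes \<Gamma> :: "'a set" and q \<rho> Lm Lhat Lg LH :: real
  assumes convex_\<Gamma>: "convex \<Gamma>" and \<Gamma>_sub: "\<Gamma> \<subseteq> U"
    and df_Lip: "Lg-lipschitz_on \<Gamma> df" and Hf_Lip: "LH-lipschitz_on \<Gamma> Hf"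
    and q: "2 < q" "q \<le> 3" and \<rho>: "0 < \<rho>" "\<rho> * (1 + Lg) < 1"
    and Lm: "0 < Lm" and Lhat: "0 < Lhat" and Lg: "0 < Lg" and LH: "0 < LH"
begin

abbreviation Xs where "Xs \<equiv> second_order_stationary f g"
abbreviation v where "v x L y \<equiv> R_model f g q x L y"

text \<open>
  The conditions on an accepted inner iteration, late in the run, that enter the local estimates. The
  decrease of \<open>F\<close> is used separately, to make the step lengths vanish.
\<close>

definition inexact_step :: "'a \<Rightarrow> real \<Rightarrow> 'a \<Rightarrow> bool"
  where "inexact_step x L y \<longleftrightarrow> x \<in> interior \<Gamma> \<and> y \<in> \<Gamma> \<and> y - v x L y \<in> \<Gamma> \<and> Lm \<le> L \<and> L \<le> Lhat \<and>
    norm (v x L y) \<le> \<rho> * L * norm (y - x) powr (q - 1)"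

definition model_gradient where
  "model_gradient x L y = df x + Hf x (y - x) + (L * norm (y - x) powr (q - 2)) *\<^sub>R (y - x)"

lemma fr_deriv_\<Gamma>: "z \<in> \<Gamma> \<Longrightarrow> (fr has_derivative (\<lambda>h. h \<bullet> df z)) (at z)"
  using fr_has_derivative \<Gamma>_sub by blast

lemma df_deriv_\<Gamma>: "z \<in> \<Gamma> \<Longrightarrow> (df has_derivative blinfun_apply (Hf z)) (at z)"
  using df_has_derivative \<Gamma>_sub by blast

lemma Hf_diff: "z \<in> \<Gamma> \<Longrightarrow> w \<in> \<Gamma> \<Longrightarrow> \<bar>(Hf z h - Hf w h) \<bullet> h\<bar> \<le> LH * norm (z - w) * (norm h)\<^sup>2"
proof -
  assume zw: "z \<in> \<Gamma>" "w \<in> \<Gamma>"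
  have "\<bar>(Hf z h - Hf w h) \<bullet> h\<bar> \<le> norm ((Hf z - Hf w) h) * norm h"
    by (metis Cauchy_Schwarz_ineq2 blinfun.diff_left)
  also have "\<dots> \<le> (norm (Hf z - Hf w) * norm h) * norm h" by (intro mult_right_mono norm_blinfun) auto
  also have "\<dots> \<le> ((LH * norm (z - w)) * norm h) * norm h"
    using lipschitz_onD[OF Hf_Lip zw] by (intro mult_right_mono) (auto simp: dist_norm)
  finally show ?thesis by (simp add: power2_eq_square mult_ac)
qed

lemma step_prox:
  assumes "inexact_step x L y"
  shows "y - v x L y = prox g (y - model_gradient x L y)"
proof -
  have x: "x \<in> interior \<Gamma>" using assms by (simp add: inexact_step_def)
  have "grad (f_model f q x L) y = model_gradient x L y"
    unfolding model_gradient_def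
    by (rule grad_f_model[OF _ Hessian_symmetric[OF convex_\<Gamma> fr_deriv_\<Gamma> df_deriv_\<Gamma> Hf_Lip x]]) (use q in auto)
  then show ?thesis by (simp add: R_model_def)
qed

lemma step_subgradient:
  assumes "inexact_step x L y"
  shows "subgradient (y - v x L y) (v x L y - model_gradient x L y)"
  using subgradient_prox[of "y - model_gradient x L y"]
  unfolding step_prox[OF assms, symmetric] by (simp add: algebra_simps)

text \<open>
  The Taylor remainder is \<open>O(t\<^sup>2)\<close>, hence \<open>O(t\<^sup>q\<^sup>-\<^sup>1)\<close> for \<open>t \<le> 1\<close> and \<open>q \<le> 3\<close>, and the regularization term
  is exactly of order \<open>t\<^sup>q\<^sup>-\<^sup>1\<close>.
\<close>

lemma model_gradient_error:
  assumes st: "inexact_step x L y" and t: "norm (y - x) \<le> 1"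
  shows "norm (model_gradient x L y - df y) \<le> (LH + Lhat) * norm (y - x) powr (q - 1)"
proof -
  let ?t = "norm (y - x)"
  have x: "x \<in> \<Gamma>" "y \<in> \<Gamma>" using st interior_subset by (auto simp: inexact_step_def)
  have "norm (df y - df x - Hf x (y - x)) \<le> LH * ?t\<^sup>2"
    by (rule gradient_taylor[OF convex_\<Gamma> df_deriv_\<Gamma> Hf_Lip x])
  also have "\<dots> \<le> LH * ?t powr (q - 1)"
  proof (cases "?t = 0")
    case False
    then show ?thesis using t q powr_mono'[of "q - 1" 2 ?t] LH by (intro mult_left_mono) auto
  qed (use LH in simp)
  finally have 1: "norm (df y - df x - Hf x (y - x)) \<le> LH * ?t powr (q - 1)" .
  have "norm ((L * ?t powr (q - 2)) *\<^sub>R (y - x)) = L * (?t * ?t powr ((q - 1) - 1))"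
    using st Lm by (simp add: inexact_step_def)
  also have "\<dots> = L * ?t powr (q - 1)" by (subst powr_minus_one_mult) auto
  also have "\<dots> \<le> Lhat * ?t powr (q - 1)" using st by (intro mult_right_mono) (auto simp: inexact_step_def)
  finally have 2: "norm ((L * ?t powr (q - 2)) *\<^sub>R (y - x)) \<le> Lhat * ?t powr (q - 1)" .
  have "model_gradient x L y - df y = (L * ?t powr (q - 2)) *\<^sub>R (y - x) - (df y - df x - Hf x (y - x))"
    by (simp add: model_gradient_def)
  then have "norm (model_gradient x L y - df y)
      \<le> norm ((L * ?t powr (q - 2)) *\<^sub>R (y - x)) + norm (df y - df x - Hf x (y - x))"
    using norm_triangle_ineq4 by metis
  then show ?thesis using 1 2 unfolding distrib_right by linarith
qed

text \<open>
  A common constant for the two residuals after a step and for the size of the subgradient of \<open>F\<close> at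
  \<open>y - v\<close>, relative to the step length to the power \<open>q - 1\<close>.
\<close>

definition Cr where "Cr = (3 + Lg) * \<rho> * Lhat + LH + Lhat"

lemma Cr_pos: "0 < Cr"
  using Lg \<rho> Lhat LH by (simp add: Cr_def add_pos_pos)

lemma v_bound:
  assumes "inexact_step x L y"
  shows "norm (v x L y) \<le> \<rho> * Lhat * norm (y - x) powr (q - 1)"
proof -
  have "norm (v x L y) \<le> \<rho> * L * norm (y - x) powr (q - 1)" using assms by (simp add: inexact_step_def)
  also have "\<dots> \<le> \<rho> * Lhat * norm (y - x) powr (q - 1)"
    using assms \<rho> by (intro mult_right_mono mult_left_mono) (auto simp: inexact_step_def)
  finally show ?thesis .
qed

lemma df_Lip_step:
  assumes "inexact_step x L y"
  shows "norm (df (y - v x L y) - df y) \<le> Lg * norm (v x L y)"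
  using lipschitz_onD[OF df_Lip, of "y - v x L y" y] assms by (simp add: inexact_step_def dist_norm)

text \<open>
  Since \<open>y - v\<close> is the proximal point of the model at \<open>y\<close>, nonexpansiveness of the
  proximal map bounds the residual at \<open>y\<close> by \<open>\<parallel>v\<parallel>\<close> plus the error of the model gradient.
\<close>

lemma residual_after_step:
  assumes st: "inexact_step x L y" and t: "norm (y - x) \<le> 1"
  shows "r y \<le> Cr * norm (y - x) powr (q - 1)" "r (y - v x L y) \<le> Cr * norm (y - x) powr (q - 1)"
proof -
  let ?s = "norm (y - x) powr (q - 1)" and ?v = "v x L y"
  have "y - prox g (y - df y) = ?v + (prox g (y - model_gradient x L y) - prox g (y - df y))"
    unfolding step_prox[OF st, symmetric] by simp
  then have "r y \<le> norm ?v + norm (prox g (y - model_gradient x L y) - prox g (y - df y))"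
    unfolding residual_def using norm_triangle_ineq by metis
  also have "norm (prox g (y - model_gradient x L y) - prox g (y - df y)) \<le> norm (model_gradient x L y - df y)"
    using prox_nonexpansive[of "y - model_gradient x L y" "y - df y"] by (simp add: norm_minus_commute)
  finally have 1: "r y \<le> norm ?v + (LH + Lhat) * ?s" using model_gradient_error[OF st t] by linarith
  have 2: "norm ?v \<le> \<rho> * Lhat * ?s" by (rule v_bound[OF st])
  have 3: "r (y - ?v) \<le> r y + (2 + Lg) * norm ?v"
    using residual_diff[of "y - ?v" y] df_Lip_step[OF st] by (simp add: algebra_simps)
  have "r (y - ?v) \<le> (3 + Lg) * norm ?v + (LH + Lhat) * ?s" using 1 3 by (simp add: algebra_simps)
  also have "(3 + Lg) * norm ?v \<le> (3 + Lg) * (\<rho> * Lhat * ?s)" using 2 Lg by (intro mult_left_mono) auto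
  finally show "r (y - ?v) \<le> Cr * ?s" by (simp add: Cr_def algebra_simps)
  have "norm ?v \<le> (3 + Lg) * norm ?v" using mult_right_mono[of 1 "3 + Lg" "norm ?v"] Lg by simp
  also have "\<dots> \<le> (3 + Lg) * (\<rho> * Lhat * ?s)" using 2 Lg by (intro mult_left_mono) auto
  finally show "r y \<le> Cr * ?s" using 1 by (simp add: Cr_def algebra_simps)
qed

text \<open>
  Second-order stationarity speaks only about displacements that end in a proximal point; this
  is why the estimates below are centred at \<open>y - v\<close> and not at \<open>y\<close>.
\<close>

lemma second_order_prox:
  assumes "p \<in> Xs" shows "0 \<le> Hf p (prox g z - p) \<bullet> (prox g z - p)"
  using assms by (simp add: second_order_stationary_def inner_commute)

text \<open>
  With \<open>h = y - v - p\<close>, monotonicity of \<open>\<partial>g\<close> gives that the difference of the model gradient and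
  \<open>\<nabla>f(p)\<close> has inner product with \<open>h\<close> at most \<open>v \<bullet> h\<close>. The difference splits into the Taylor error at
  \<open>p\<close>, the Hessian at \<open>x\<close> applied to \<open>h\<close> and to \<open>v\<close>, and the regularization term; the Hessian term in \<open>h\<close> is
  nonnegative up to \<open>LH \<parallel>x - p\<parallel> \<parallel>h\<parallel>\<^sup>2\<close>.
\<close>

lemma step_length_le_distance:
  "\<exists>T>0. \<exists>C>0. \<forall>x L y p. inexact_step x L y \<longrightarrow> norm (y - x) \<le> T \<longrightarrow> p \<in> Xs \<longrightarrow> p \<in> \<Gamma> \<longrightarrow>
     norm (y - x) \<le> C * norm (x - p)"
proof -
  let ?A = "1 + Lg"
  define c0 where "c0 = 1 - \<rho> * ?A"
  have c0: "0 < c0" using \<rho> by (simp add: c0_def)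
  define \<theta> where "\<theta> = min (c0 / 8) (Lm * c0 / (48 * LH))"
  have \<theta>: "0 < \<theta>" "\<theta> \<le> c0 / 8" using c0 Lm LH by (auto simp: \<theta>_def)
  have "24 * LH * \<theta> \<le> 24 * LH * (Lm * c0 / (48 * LH))"
    using LH by (intro mult_left_mono) (auto simp: \<theta>_def)
  also have "\<dots> < Lm * c0" using Lm c0 LH by (simp add: field_simps)
  finally have \<theta>2: "24 * LH * \<theta> < Lm * c0" .
  \<comment> \<open>As \<open>q > 2\<close>, steps of length at most \<open>T\<close> have inexactness \<open>\<parallel>v\<parallel> \<le> \<rho> Lhat t powr (q - 1) \<le> \<theta> t\<close>.\<close>
  define T where "T = min 1 ((\<theta> / (\<rho> * Lhat)) powr (1 / (q - 2)))"
  have T: "0 < T" "T \<le> 1" using \<theta> \<rho> Lhat by (auto simp: T_def)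
  have "norm (y - x) \<le> (1 / \<theta>) * norm (x - p)"
    if st: "inexact_step x L y" and tT: "norm (y - x) \<le> T" and p: "p \<in> Xs" "p \<in> \<Gamma>" for x L y p
  proof (rule ccontr)
    assume neg: "\<not> ?thesis"
    define t d n h where "t = norm (y - x)" and "d = norm (x - p)" and "n = norm (v x L y)"
      and "h = y - v x L y - p"
    define a where "a = norm h"
    have d: "d < \<theta> * t" using neg \<theta> by (simp add: t_def d_def field_simps)
    have tpos: "0 < t"
    proof -
      have "0 \<le> d" by (simp add: d_def)
      then have "0 < \<theta> * t" using d by linarith
      then show ?thesis using \<theta> by (simp add: zero_less_mult_iff)
    qed
    have x: "x \<in> interior \<Gamma>" "x \<in> \<Gamma>" using st interior_subset by (auto simp: inexact_step_def)
    have L: "Lm \<le> L" "0 < L" using st Lm by (auto simp: inexact_step_def)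
    have nL: "n \<le> \<rho> * L * t powr (q - 1)" using st by (simp add: inexact_step_def n_def t_def)
    have n\<theta>: "n \<le> \<theta> * t"
    proof -
      have "t powr (q - 2) \<le> ((\<theta> / (\<rho> * Lhat)) powr (1 / (q - 2))) powr (q - 2)"
        using tT tpos q by (intro powr_mono2) (auto simp: T_def t_def)
      also have "\<dots> = \<theta> / (\<rho> * Lhat)" using q \<theta> \<rho> Lhat by (simp add: powr_powr)
      finally have "\<rho> * Lhat * t powr (q - 2) \<le> \<theta>" using \<rho> Lhat by (simp add: field_simps)
      then have "\<rho> * Lhat * t powr (q - 2) * t \<le> \<theta> * t" using tpos by (intro mult_right_mono) auto
      moreover have "t powr (q - 2) * t = t powr (q - 1)"
        using powr_minus_one_mult[of t "q - 1"] tpos by (simp add: mult.commute)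
      ultimately have "\<rho> * Lhat * t powr (q - 1) \<le> \<theta> * t" by (simp only: mult.assoc)
      then show ?thesis using v_bound[OF st] by (simp add: n_def t_def)
    qed
    have aT: "a \<le> t + n + d"
    proof -
      have "h = (y - x) - v x L y + (x - p)" by (simp add: h_def)
      then show ?thesis
        using norm_triangle_ineq[of "(y - x) - v x L y" "x - p"] norm_triangle_ineq4[of "y - x" "v x L y"]
        by (simp add: a_def t_def n_def d_def)
    qed
    have psub: "subgradient p (- df p)" using p by (simp add: second_order_stationary_def stationary_iff)
    have mono: "(model_gradient x L y - df p) \<bullet> h \<le> v x L y \<bullet> h"
      using subgradient_monotone[OF step_subgradient[OF st] psub]
      by (simp add: h_def inner_diff_left algebra_simps)
    define e1 where "e1 = df p - df x - Hf x (p - x)"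
    have e1: "norm e1 \<le> LH * d\<^sup>2"
      using gradient_taylor[OF convex_\<Gamma> df_deriv_\<Gamma> Hf_Lip x(2) p(2)]
      by (simp add: e1_def d_def norm_minus_commute)
    have Hv: "norm (Hf x (v x L y)) \<le> Lg * n"
      unfolding n_def by (rule derivative_norm_le_Lipschitz[OF df_deriv_\<Gamma>[OF x(2)] df_Lip x(1)])
    have "y - x = h + v x L y + (p - x)" by (simp add: h_def)
    then have "Hf x (y - x) = Hf x h + Hf x (v x L y) + Hf x (p - x)"
      by (simp only: blinfun.add_right)
    then have split: "model_gradient x L y - df p
        = - e1 + Hf x h + Hf x (v x L y) + (L * t powr (q - 2)) *\<^sub>R (y - x)"
      by (simp add: model_gradient_def e1_def t_def)
    have "0 \<le> Hf p h \<bullet> h"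
      using second_order_prox[OF p(1), of "y - model_gradient x L y"] unfolding step_prox[OF st, symmetric] h_def .
    moreover have "\<bar>(Hf x h - Hf p h) \<bullet> h\<bar> \<le> LH * d * a\<^sup>2"
      using Hf_diff[OF x(2) p(2)] by (simp add: d_def a_def)
    ultimately have Hh: "- (LH * d * a\<^sup>2) \<le> Hf x h \<bullet> h" by (simp add: inner_diff_left)
    have i1: "e1 \<bullet> h \<le> LH * d\<^sup>2 * a"
      unfolding a_def by (rule order_trans[OF norm_cauchy_schwarz]) (use e1 in \<open>simp add: mult_right_mono\<close>)
    have i2: "- (Hf x (v x L y) \<bullet> h) \<le> Lg * n * a"
    proof -
      have "- (Hf x (v x L y) \<bullet> h) \<le> norm (Hf x (v x L y)) * norm h"
        using Cauchy_Schwarz_ineq2[of "Hf x (v x L y)" h] by linarith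
      also have "\<dots> \<le> Lg * n * a" unfolding a_def using Hv by (intro mult_right_mono) auto
      finally show ?thesis .
    qed
    have i3: "v x L y \<bullet> h \<le> n * a" unfolding a_def n_def by (rule norm_cauchy_schwarz)
    have inner: "t * (t - n - d) \<le> (y - x) \<bullet> h"
    proof -
      have h: "h = (y - x) - (v x L y - (x - p))" by (simp add: h_def)
      have "(y - x) \<bullet> (v x L y - (x - p)) \<le> t * norm (v x L y - (x - p))"
        unfolding t_def by (rule norm_cauchy_schwarz)
      also have "\<dots> \<le> t * (n + d)"
        using norm_triangle_ineq4[of "v x L y" "x - p"] tpos by (intro mult_left_mono) (auto simp: n_def d_def)
      finally have "(y - x) \<bullet> (v x L y - (x - p)) \<le> t * (n + d)" .
      moreover have "(y - x) \<bullet> h = (y - x) \<bullet> (y - x) - (y - x) \<bullet> (v x L y - (x - p))"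
        by (subst h) (rule inner_diff_right)
      ultimately have "(y - x) \<bullet> (y - x) - t * (n + d) \<le> (y - x) \<bullet> h" by linarith
      then show ?thesis by (simp add: dot_square_norm t_def power2_eq_square algebra_simps)
    qed
    have "(L * t powr (q - 2)) * ((y - x) \<bullet> h) \<le> a * (?A * n + LH * d\<^sup>2 + LH * d * a)"
      using mono Hh i1 i2 i3 unfolding split
      by (simp add: inner_add_left power2_eq_square algebra_simps)
    moreover have "(L * t powr (q - 2)) * (t * (t - n - d)) \<le> (L * t powr (q - 2)) * ((y - x) \<bullet> h)"
      using inner L by (intro mult_left_mono) auto
    moreover have "(L * t powr (q - 2)) * (t * (t - n - d)) = L * t powr (q - 1) * (t - n - d)"
      using powr_minus_one_mult[of t "q - 1"] tpos by (simp add: mult_ac)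
    ultimately have main: "L * t powr (q - 1) * (t - n - d) \<le> a * (?A * n + LH * d\<^sup>2 + LH * d * a)" by linarith
    show False
      by (rule step_length_contradiction[OF q tpos _ _ nL n\<theta> _ d _ aT Lm L(1) _ \<rho>(1) \<rho>(2) LH \<theta>(1) _ _ main])
        (use tT T Lg \<theta> \<theta>2 in \<open>auto simp: t_def d_def n_def a_def c0_def\<close>)
  qed
  then show ?thesis using T \<theta> by (intro exI[of _ T] conjI exI[of _ "1 / \<theta>"]) auto
qed

text \<open>
  The convex part contributes its subgradient at \<open>z = y - v\<close>, and the smooth part its second-order Taylor
  expansion at \<open>z\<close>. The quadratic term enters with the sign that helps, by second-order stationarity
  of \<open>p\<close>, so that only a cubic error is left.
\<close>

lemma value_gap_after_step:
  assumes st: "inexact_step x L y" and t: "norm (y - x) \<le> 1" and p: "p \<in> Xs" "p \<in> \<Gamma>"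
  shows "Fr (y - v x L y) - Fr p \<le> Cr * norm (y - x) powr (q - 1) * norm (y - v x L y - p)
    + 2 * LH * norm (y - v x L y - p) ^ 3"
proof -
  let ?s = "norm (y - x) powr (q - 1)" and ?v = "v x L y"
  define z where "z = y - ?v"
  define h where "h = z - p"
  define \<xi> where "\<xi> = ?v - model_gradient x L y + df z"
  have z: "z \<in> \<Gamma>" using st by (simp add: inexact_step_def z_def)
  have zs: "subgradient z (?v - model_gradient x L y)" unfolding z_def by (rule step_subgradient[OF st])
  have pD: "p \<in> D" using p by (simp add: second_order_stationary_def stationary_iff subgradient_def)
  have g: "gr z - gr p \<le> (?v - model_gradient x L y) \<bullet> h"
  proof -
    have "(?v - model_gradient x L y) \<bullet> (p - z) \<le> gr p - gr z" using zs pD by (simp add: subgradient_def)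
    moreover have "(?v - model_gradient x L y) \<bullet> (p - z) = - ((?v - model_gradient x L y) \<bullet> h)"
      unfolding h_def by (metis inner_minus_right minus_diff_eq)
    ultimately show ?thesis by linarith
  qed
  have "\<bar>fr p - fr z - df z \<bullet> (p - z) - 1/2 * (Hf z (p - z) \<bullet> (p - z))\<bar> \<le> LH * norm (p - z)^3"
    by (rule value_taylor[OF convex_\<Gamma> fr_deriv_\<Gamma> df_deriv_\<Gamma> Hf_Lip z p(2)])
  moreover have "p - z = - h" by (simp add: h_def)
  ultimately have f: "\<bar>fr p - fr z + df z \<bullet> h - 1/2 * (Hf z h \<bullet> h)\<bar> \<le> LH * norm h^3"
    by (simp add: blinfun.minus_right)
  have "0 \<le> Hf p h \<bullet> h"
    using second_order_prox[OF p(1), of "y - model_gradient x L y"]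
    unfolding step_prox[OF st, symmetric] h_def z_def .
  moreover have "\<bar>(Hf z h - Hf p h) \<bullet> h\<bar> \<le> LH * norm h ^ 3"
    using Hf_diff[OF z p(2), of h] by (simp add: h_def power2_eq_square power3_eq_cube mult_ac)
  ultimately have H: "- (LH * norm h ^ 3) \<le> Hf z h \<bullet> h" by (simp add: inner_diff_left)
  have "norm \<xi> \<le> norm ?v + norm (model_gradient x L y - df y) + norm (df z - df y)"
  proof -
    have "\<xi> = ?v - (model_gradient x L y - df y) + (df z - df y)" by (simp add: \<xi>_def)
    then have "norm \<xi> = norm (?v - (model_gradient x L y - df y) + (df z - df y))" by (rule arg_cong)
    then show ?thesis
      using norm_triangle_ineq[of "?v - (model_gradient x L y - df y)" "df z - df y"]
        norm_triangle_ineq4[of ?v "model_gradient x L y - df y"] by linarith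
  qed
  also have "norm (df z - df y) \<le> Lg * norm ?v" unfolding z_def by (rule df_Lip_step[OF st])
  finally have "norm \<xi> \<le> (1 + Lg) * norm ?v + (LH + Lhat) * ?s"
    using model_gradient_error[OF st t] by (simp add: algebra_simps)
  also have "(1 + Lg) * norm ?v \<le> (3 + Lg) * (\<rho> * Lhat * ?s)"
    using v_bound[OF st] Lg by (intro mult_mono) auto
  finally have \<xi>: "norm \<xi> \<le> Cr * ?s" by (simp add: Cr_def algebra_simps)
  have "\<xi> \<bullet> h \<le> Cr * ?s * norm h"
    by (rule order_trans[OF norm_cauchy_schwarz]) (use \<xi> in \<open>simp add: mult_right_mono\<close>)
  then have "Fr z - Fr p \<le> Cr * ?s * norm h + 2 * (LH * norm h ^ 3)"
    using f g H LH unfolding \<xi>_def inner_add_left by (simp add: abs_le_iff) 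
  then show ?thesis by (simp add: h_def z_def)
qed

end

section \<open>Convergence of the iterates\<close>

lemma infdist_attained_up_to:
  assumes "A \<noteq> {}" "infdist x A < b" shows "\<exists>a\<in>A. dist x a < b"
proof -
  have "Inf (dist x ` A) < b" using assms by (simp add: infdist_def)
  then show ?thesis using cInf_lessD[of "dist x ` A" b] assms(1) by auto
qed

text \<open>
  The potential \<open>dist (xs m) z + 2 B (d m)\<close> does not increase along the sequence as long as it is
  below \<open>R\<close>: a move costs at most \<open>B (d m)\<close> in the first term, and the halving of \<open>d\<close> pays for it.
  It is arbitrarily small at suitable iterates because \<open>z\<close> is an accumulation point.
\<close>

lemma trapped_sequence_converges:
  fixes xs :: "nat \<Rightarrow> 'b::metric_space"
  assumes R: "0 < R" and B: "0 \<le> B"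
    and acc: "\<And>e N. 0 < e \<Longrightarrow> \<exists>n\<ge>N. dist (xs n) z < e"
    and d: "\<And>k. 0 \<le> d k" "\<And>k. d k \<le> dist (xs k) z"
    and step: "\<And>k. K \<le> k \<Longrightarrow> dist (xs k) z \<le> R \<Longrightarrow>
      dist (xs (Suc k)) (xs k) \<le> B * d k \<and> d (Suc k) \<le> d k / 2"
  shows "xs \<longlonglongrightarrow> z"
proof (rule metric_LIMSEQ_I)
  fix e :: real assume "0 < e"
  define e' where "e' = min e R"
  have e': "0 < e'" "e' \<le> e" "e' \<le> R" using \<open>0 < e\<close> R by (auto simp: e'_def)
  obtain n where n: "n \<ge> K" "dist (xs n) z < e' / (1 + 2 * B)"
    using acc[of "e' / (1 + 2 * B)" K] e' B by auto
  have inv: "dist (xs m) z + 2 * B * d m < e'" if "n \<le> m" for m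
    using that
  proof (induction rule: dec_induct)
    case base
    have "2 * B * d n \<le> 2 * B * dist (xs n) z" using d B by (intro mult_left_mono) auto
    then have "dist (xs n) z + 2 * B * d n \<le> (1 + 2 * B) * dist (xs n) z" by (simp add: algebra_simps)
    also have "\<dots> < e'" using n B by (simp add: pos_less_divide_eq mult.commute)
    finally show ?case .
  next
    case (step m)
    have "0 \<le> 2 * B * d m" using B d by simp
    then have "dist (xs m) z \<le> R" using step e' by linarith
    then have s: "dist (xs (Suc m)) (xs m) \<le> B * d m" "d (Suc m) \<le> d m / 2"
      using assms(6)[of m] step n by auto
    have "2 * B * d (Suc m) \<le> 2 * B * (d m / 2)" using s B by (intro mult_left_mono) auto
    then show ?case using s dist_triangle[of "xs (Suc m)" z "xs m"] step by simp
  qed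
  have "dist (xs m) z < e" if "n \<le> m" for m
  proof -
    have "0 \<le> 2 * B * d m" using B d by simp
    then show ?thesis using inv[OF that] e' by linarith
  qed
  then show "\<exists>no. \<forall>n\<ge>no. dist (xs n) z < e" by blast
qed

text \<open>
  A run of the method reduced to what governs its tail; \<open>\<epsilon>b\<close> is the radius of a ball
  around the accumulation point on which the Lipschitz estimates are available.
\<close>

locale newton_sequence = regularized_newton g f U \<Gamma> q \<rho> Lm Lhat Lg LH
  for g f :: "'a::euclidean_space \<Rightarrow> ereal" and U \<Gamma> and q \<rho> Lm Lhat Lg LH +
  fixes xs ys :: "nat \<Rightarrow> 'a" and Ls :: "nat \<Rightarrow> real" and k0 :: nat and xb :: 'a and \<epsilon>b :: real
  assumes xs_D: "xs k \<in> D"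
    and step: "k0 \<le> k \<Longrightarrow> inexact_step (xs k) (Ls k) (ys k)"
    and next_cases: "xs (Suc k) = ys k \<or> xs (Suc k) = ys k - v (xs k) (Ls k) (ys k)"
    and next_value: "Fr (xs (Suc k)) \<le> Fr (ys k - v (xs k) (Ls k) (ys k))"
    and step_length_tendsto: "(\<lambda>k. norm (ys k - xs k)) \<longlonglongrightarrow> 0"
    and xb_acc: "xb \<in> accumulation_points xs"
    and \<epsilon>b: "0 < \<epsilon>b" "cball xb \<epsilon>b \<subseteq> \<Gamma>"
begin

abbreviation t where "t k \<equiv> norm (ys k - xs k)"
abbreviation d where "d k \<equiv> infdist (xs k) Xs"

lemma xb_in: "xb \<in> \<Gamma>" "xb \<in> U"
  using \<epsilon>b \<Gamma>_sub by (auto simp: subset_iff)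

lemma eventually_step: "\<forall>\<^sub>F k in sequentially. inexact_step (xs k) (Ls k) (ys k)"
  using step eventually_sequentially by blast

lemma eventually_t_le: "0 < e \<Longrightarrow> \<forall>\<^sub>F k in sequentially. t k \<le> e"
  using order_tendstoD(2)[OF step_length_tendsto, of e] by (auto elim: eventually_mono)

text \<open>
  The residuals of all iterates tend to zero, and the residual is continuous at \<open>xb\<close>.
\<close>

lemma accumulation_point_stationary: "xb \<in> stationary f g"
proof -
  obtain s where s: "strict_mono s" "(xs \<circ> s) \<longlonglongrightarrow> xb"
    using xb_acc by (auto simp: accumulation_points_def)
  have "(\<lambda>k. r (xs (Suc k))) \<longlonglongrightarrow> 0"
  proof (rule tendsto_sandwich[of "\<lambda>_. 0" _ _ "\<lambda>k. Cr * t k powr (q - 1)"])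
    show "\<forall>\<^sub>F k in sequentially. r (xs (Suc k)) \<le> Cr * t k powr (q - 1)"
      using eventually_step eventually_t_le[of 1, simplified]
    proof eventually_elim
      case (elim k)
      then show ?case using residual_after_step[OF elim] next_cases[of k] by auto
    qed
    have "(\<lambda>k. Cr * t k powr (q - 1)) \<longlonglongrightarrow> Cr * 0 powr (q - 1)"
      using q by (intro tendsto_intros tendsto_powr' step_length_tendsto) auto
    then show "(\<lambda>k. Cr * t k powr (q - 1)) \<longlonglongrightarrow> 0" by simp
  qed (auto simp: residual_nonneg)
  then have "(\<lambda>k. r (xs k)) \<longlonglongrightarrow> 0" by (subst (asm) filterlim_sequentially_Suc)
  from LIMSEQ_subseq_LIMSEQ[OF this s(1)] have r0: "(\<lambda>n. r (xs (s n))) \<longlonglongrightarrow> 0" by (simp add: o_def)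
  have x: "(\<lambda>n. xs (s n)) \<longlonglongrightarrow> xb" using s(2) by (simp add: o_def)
  have "(\<lambda>n. r xb - r (xs (s n))) \<longlonglongrightarrow> 0"
  proof (rule Lim_null_comparison)
    show "\<forall>\<^sub>F n in sequentially. norm (r xb - r (xs (s n)))
        \<le> 2 * norm (xb - xs (s n)) + norm (df xb - df (xs (s n)))"
      using residual_diff by simp
    have "(\<lambda>n. df (xs (s n))) \<longlonglongrightarrow> df xb" by (rule isCont_tendsto_compose[OF isCont_df[OF xb_in(2)] x])
    then have "(\<lambda>n. 2 * norm (xb - xs (s n)) + norm (df xb - df (xs (s n))))
        \<longlonglongrightarrow> 2 * norm (xb - xb) + norm (df xb - df xb)"
      by (intro tendsto_intros x)
    then show "(\<lambda>n. 2 * norm (xb - xs (s n)) + norm (df xb - df (xs (s n)))) \<longlonglongrightarrow> 0" by simp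
  qed
  from tendsto_add[OF this r0] have "(\<lambda>n. r xb) \<longlonglongrightarrow> 0" by simp
  then have "r xb = 0" by (simp add: LIMSEQ_const_iff)
  then show ?thesis by (rule residual_zero_imp_stationary)
qed

lemma residual_xb: "r xb = 0"
  using accumulation_point_stationary prox_eqI[of xb "xb - df xb"]
  by (simp add: stationary_iff residual_def)

lemma accumulation_point_near: "0 < e \<Longrightarrow> \<exists>n\<ge>N. dist (xs n) xb < e"
proof -
  assume e: "0 < e"
  obtain s where s: "strict_mono s" "(xs \<circ> s) \<longlonglongrightarrow> xb"
    using xb_acc by (auto simp: accumulation_points_def)
  obtain M where "\<And>n. n \<ge> M \<Longrightarrow> dist (xs (s n)) xb < e"
    using metric_LIMSEQ_D[OF s(2) e] by auto
  then have "dist (xs (s (max M N))) xb < e" by simp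
  moreover have "N \<le> s (max M N)" using seq_suble[OF s(1), of "max M N"] by simp
  ultimately show ?thesis by blast
qed

lemma move_bound:
  assumes st: "inexact_step (xs k) (Ls k) (ys k)" and t1: "t k \<le> 1"
  shows "norm (ys k - v (xs k) (Ls k) (ys k) - xs k) \<le> (1 + \<rho> * Lhat) * t k"
    "norm (xs (Suc k) - xs k) \<le> (1 + \<rho> * Lhat) * t k"
proof -
  have "t k powr (q - 1) \<le> t k"
  proof (cases "t k = 0")
    case False
    then show ?thesis using powr_mono'[of 1 "q - 1" "t k"] q t1 by simp
  qed simp
  then have "\<rho> * Lhat * t k powr (q - 1) \<le> \<rho> * Lhat * t k"
    using \<rho> Lhat by (intro mult_left_mono) auto
  then have nv: "norm (v (xs k) (Ls k) (ys k)) \<le> \<rho> * Lhat * t k"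
    using v_bound[OF st] by linarith
  show 1: "norm (ys k - v (xs k) (Ls k) (ys k) - xs k) \<le> (1 + \<rho> * Lhat) * t k"
    using norm_triangle_ineq4[of "ys k - xs k" "v (xs k) (Ls k) (ys k)"] nv by (simp add: algebra_simps)
  show "norm (xs (Suc k) - xs k) \<le> (1 + \<rho> * Lhat) * t k"
    using next_cases[of k]
  proof
    assume "xs (Suc k) = ys k"
    moreover have "1 * t k \<le> (1 + \<rho> * Lhat) * t k" using \<rho> Lhat by (intro mult_right_mono) auto
    ultimately show ?thesis by simp
  qed (use 1 in simp)
qed

end

locale newton_sequence_error_bound = newton_sequence g f U \<Gamma> q \<rho> Lm Lhat Lg LH xs ys Ls k0 xb \<epsilon>b
  for g f :: "'a::euclidean_space \<Rightarrow> ereal" and U \<Gamma> and q \<rho> Lm Lhat Lg LH and xs ys Ls k0 xb \<epsilon>b +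
  fixes \<epsilon>h \<kappa> \<gamma> :: real
  assumes \<epsilon>h: "0 < \<epsilon>h" and \<kappa>: "0 < \<kappa>" and \<gamma>: "1 / (q - 1) < \<gamma>" "\<gamma> \<le> 1"
    and Xs_nonempty: "Xs \<noteq> {}"
    and error_bound: "z \<in> U \<Longrightarrow> norm (z - xb) \<le> \<epsilon>h \<Longrightarrow> infdist z Xs \<le> \<kappa> * r z powr \<gamma>"
begin

abbreviation P where "P \<equiv> \<gamma> * (q - 1)"

lemma \<gamma>_pos: "0 < \<gamma>"
proof -
  have "0 < 1 / (q - 1)" using q by simp
  then show ?thesis using \<gamma> by linarith
qed

lemma P_gt_1: "1 < P"
  using \<gamma> q by (simp add: field_simps)

lemma infdist_xb: "infdist xb Xs = 0"
  using error_bound[of xb] xb_in(2) \<epsilon>h residual_xb infdist_nonneg[of xb Xs] by simp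

lemma d_le_dist: "infdist z Xs \<le> norm (z - xb)"
  using infdist_triangle[of z Xs xb] infdist_xb by (simp add: dist_norm)

text \<open>
  The set \<open>Xs\<close> need not be closed, so the distance may not be attained; the slack \<open>e\<close> is sent to zero
  wherever this lemma is applied.
\<close>

lemma near_second_order_point:
  assumes "norm (z - xb) + infdist z Xs + e \<le> \<epsilon>b" "0 < e"
  shows "\<exists>p\<in>Xs. p \<in> \<Gamma> \<and> norm (z - p) < infdist z Xs + e \<and> norm (p - xb) < norm (z - xb) + infdist z Xs + e"
proof -
  obtain p where p: "p \<in> Xs" "norm (z - p) < infdist z Xs + e"
    using infdist_attained_up_to[OF Xs_nonempty, of z "infdist z Xs + e"] assms by (auto simp: dist_norm)
  have "norm (p - xb) \<le> norm (z - xb) + norm (z - p)"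
    using norm_triangle_ineq4[of "z - xb" "z - p"] by simp
  then have "norm (p - xb) < norm (z - xb) + infdist z Xs + e" using p by linarith
  moreover from this have "p \<in> \<Gamma>" using assms \<epsilon>b by (auto simp: dist_norm norm_minus_commute)
  ultimately show ?thesis using p by blast
qed

text \<open>
  The radius \<open>\<epsilon>b / 4\<close> leaves room for the reference point: it lies within three such radii of
  \<open>xb\<close>, hence in \<open>\<Gamma>\<close>.
\<close>

lemma step_length_le_d:
  "\<exists>C>0. \<forall>\<^sub>F k in sequentially. norm (xs k - xb) \<le> \<epsilon>b / 4 \<longrightarrow> t k \<le> C * d k"
proof -
  obtain T C where T: "0 < T" and C: "0 < C"
    and key: "\<And>x L y p. inexact_step x L y \<Longrightarrow> norm (y - x) \<le> T \<Longrightarrow> p \<in> Xs \<Longrightarrow> p \<in> \<Gamma> \<Longrightarrow>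
      norm (y - x) \<le> C * norm (x - p)"
    using step_length_le_distance by blast
  have "\<forall>\<^sub>F k in sequentially. norm (xs k - xb) \<le> \<epsilon>b / 4 \<longrightarrow> t k \<le> C * d k"
    using eventually_step eventually_t_le[OF T]
  proof eventually_elim
    case (elim k)
    show ?case
    proof
      assume near: "norm (xs k - xb) \<le> \<epsilon>b / 4"
      have "t k / C \<le> d k + e" if e: "0 < e" for e
      proof -
        have "norm (xs k - xb) + d k + min e (\<epsilon>b / 4) \<le> \<epsilon>b" using near d_le_dist[of "xs k"] \<epsilon>b by linarith
        then obtain p where p: "p \<in> Xs" "p \<in> \<Gamma>" "norm (xs k - p) < d k + min e (\<epsilon>b / 4)"
          using near_second_order_point e \<epsilon>b by (metis min_less_iff_conj zero_less_divide_iff zero_less_numeral)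
        have "t k \<le> C * norm (xs k - p)" by (rule key[OF elim p(1,2)])
        also have "\<dots> \<le> C * (d k + e)" using p C by (intro mult_left_mono) auto
        finally show ?thesis using C by (simp add: pos_divide_le_eq mult.commute)
      qed
      then have "t k / C \<le> d k" by (rule field_le_epsilon)
      then show "t k \<le> C * d k" using C by (simp add: pos_divide_le_eq mult.commute)
    qed
  qed
  then show ?thesis using C by blast
qed

lemma error_bound_powr:
  assumes "z \<in> U" "norm (z - xb) \<le> \<epsilon>h" "r z \<le> Cr * s powr (q - 1)" "0 \<le> s"
  shows "infdist z Xs \<le> \<kappa> * Cr powr \<gamma> * s powr P"
proof -
  have "infdist z Xs \<le> \<kappa> * r z powr \<gamma>" using error_bound assms by blast
  also have "\<dots> \<le> \<kappa> * (Cr * s powr (q - 1)) powr \<gamma>"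
    using assms \<kappa> \<gamma>_pos residual_nonneg by (intro mult_left_mono powr_mono2) auto
  also have "\<dots> = \<kappa> * Cr powr \<gamma> * s powr P"
    using Cr_pos by (simp add: powr_mult powr_powr mult_ac)
  finally show ?thesis .
qed

text \<open>
  Since \<open>P > 1\<close>, the bound \<open>O(t\<^sup>P)\<close> for the next distance is a vanishing factor times \<open>t\<close>, which is
  \<open>O(d)\<close>. The step lengths vanish along the whole sequence, so the factor is
  eventually below one half, and the trapping lemma applies.
\<close>

lemma converges: "xs \<longlonglongrightarrow> xb"
proof -
  obtain C where C: "0 < C"
    and td: "\<forall>\<^sub>F k in sequentially. norm (xs k - xb) \<le> \<epsilon>b / 4 \<longrightarrow> t k \<le> C * d k"
    using step_length_le_d by blast
  define M where "M = 1 + \<rho> * Lhat"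
  have M: "0 < M" using \<rho> Lhat by (simp add: M_def add_pos_pos)
  define R where "R = min (\<epsilon>b / 4) (\<epsilon>h / 2)"
  have R: "0 < R" using \<epsilon>b \<epsilon>h by (simp add: R_def)
  have "(\<lambda>k. \<kappa> * Cr powr \<gamma> * C * t k powr (P - 1)) \<longlonglongrightarrow> \<kappa> * Cr powr \<gamma> * C * 0 powr (P - 1)"
    using P_gt_1 by (intro tendsto_intros tendsto_powr' step_length_tendsto) auto
  then have small: "\<forall>\<^sub>F k in sequentially. \<kappa> * Cr powr \<gamma> * C * t k powr (P - 1) < 1 / 2"
    by (intro order_tendstoD(2)) auto
  have "0 < min 1 (\<epsilon>h / (2 * M))" using \<epsilon>h M by simp
  from td small eventually_step eventually_t_le[OF this]
  have "\<forall>\<^sub>F k in sequentially. dist (xs k) xb \<le> R \<longrightarrow>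
      dist (xs (Suc k)) (xs k) \<le> (M * C) * d k \<and> d (Suc k) \<le> d k / 2"
  proof eventually_elim
    case (elim k)
    show ?case
    proof
      assume near: "dist (xs k) xb \<le> R"
      have tk: "t k \<le> 1" "t k \<le> \<epsilon>h / (2 * M)" using elim by auto
      have tC: "t k \<le> C * d k" using elim near by (simp add: R_def dist_norm)
      have mv: "norm (xs (Suc k) - xs k) \<le> M * t k" unfolding M_def by (rule move_bound(2)[OF elim(3) tk(1)])
      also have "\<dots> \<le> M * (C * d k)" using tC M by (intro mult_left_mono) auto
      finally have 1: "norm (xs (Suc k) - xs k) \<le> (M * C) * d k" by simp
      have "M * t k \<le> \<epsilon>h / 2" using tk(2) M by (simp add: field_simps)
      then have nb: "norm (xs (Suc k) - xb) \<le> \<epsilon>h"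
        using mv near norm_triangle_ineq[of "xs (Suc k) - xs k" "xs k - xb"] by (simp add: R_def dist_norm)
      have rs: "r (xs (Suc k)) \<le> Cr * t k powr (q - 1)"
        using residual_after_step[OF elim(3) tk(1)] next_cases[of k] by auto
      have "d (Suc k) \<le> \<kappa> * Cr powr \<gamma> * t k powr P"
        using error_bound_powr[OF _ nb rs] xs_D[of "Suc k"] D_subset_U by auto
      also have "\<dots> = \<kappa> * Cr powr \<gamma> * t k powr (P - 1) * t k"
        using powr_minus_one_mult[of "t k" P] by (simp add: mult_ac)
      also have "\<dots> \<le> \<kappa> * Cr powr \<gamma> * t k powr (P - 1) * (C * d k)"
        using tC \<kappa> by (intro mult_left_mono) auto
      also have "\<dots> = (\<kappa> * Cr powr \<gamma> * C * t k powr (P - 1)) * d k" by (simp add: mult_ac)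
      also have "\<dots> \<le> 1 / 2 * d k" using elim(2) infdist_nonneg by (intro mult_right_mono) auto
      finally show "dist (xs (Suc k)) (xs k) \<le> (M * C) * d k \<and> d (Suc k) \<le> d k / 2"
        using 1 by (simp add: dist_norm)
    qed
  qed
  then obtain K where K: "\<And>k. K \<le> k \<Longrightarrow> dist (xs k) xb \<le> R \<Longrightarrow>
      dist (xs (Suc k)) (xs k) \<le> (M * C) * d k \<and> d (Suc k) \<le> d k / 2"
    unfolding eventually_sequentially by blast
  show ?thesis
  proof (rule trapped_sequence_converges[where d = d and K = K and B = "M * C"])
    show "0 < R" by (rule R)
    show "0 \<le> M * C" using M C by simp
  qed (use K accumulation_point_near infdist_nonneg d_le_dist in \<open>auto simp: dist_norm\<close>)
qed

section \<open>Decrease of the objective values\<close>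

text \<open>
  For \<open>z = y - v\<close> and a nearby point \<open>p\<close> of \<open>Xs\<close>, whose value is at most \<open>F(xb)\<close>, the linear term of the
  value gap is \<open>O(t\<^sup>q\<^sup>-\<^sup>1 t\<^sup>P)\<close>, which is the claimed order. The cubic term is \<open>O(t\<^sup>3\<^sup>P)\<close>, and this is of no lower
  order because \<open>\<gamma> > 1 / (q - 1) \<ge> 1 / 2\<close>.
\<close>

lemma value_gap_le_step_length:
  assumes KL: "KL_at (\<lambda>z. f z + g z) xb"
  shows "\<exists>M>0. \<forall>\<^sub>F k in sequentially. Fr (xs (Suc k)) - Fr xb \<le> M * t k powr ((1 + \<gamma>) * (q - 1))"
proof -
  define \<kappa>' where "\<kappa>' = \<kappa> * Cr powr \<gamma>"
  have \<kappa>': "0 < \<kappa>'" using \<kappa> Cr_pos by (simp add: \<kappa>'_def)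
  have xbD: "xb \<in> D" using accumulation_point_stationary by (simp add: stationary_iff subgradient_def)
  obtain e1 where e1: "0 < e1" "\<And>p. p \<in> stationary f g \<Longrightarrow> norm (p - xb) < e1 \<Longrightarrow> Fr p \<le> Fr xb"
    using KL_stationary_value[OF KL xbD] by blast
  define e2 where "e2 = min e1 (min \<epsilon>b \<epsilon>h) / 2"
  have e2: "0 < e2" "2 * e2 \<le> e1" "2 * e2 \<le> \<epsilon>b" "e2 \<le> \<epsilon>h" using e1 \<epsilon>b \<epsilon>h by (auto simp: e2_def)
  define z where "z k = ys k - v (xs k) (Ls k) (ys k)" for k
  define a where "a k = \<kappa>' * t k powr P" for k
  have "(\<lambda>k. norm (xs k - xb) + (1 + \<rho> * Lhat) * t k + a k) \<longlonglongrightarrow>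
      norm (xb - xb) + (1 + \<rho> * Lhat) * 0 + \<kappa>' * 0 powr P"
    unfolding a_def using P_gt_1 by (intro tendsto_intros tendsto_powr' step_length_tendsto converges) auto
  then have "\<forall>\<^sub>F k in sequentially. norm (xs k - xb) + (1 + \<rho> * Lhat) * t k + a k < e2"
    using e2 by (intro order_tendstoD(2)) auto
  with eventually_step eventually_t_le[of 1, simplified]
  have "\<forall>\<^sub>F k in sequentially. Fr (xs (Suc k)) - Fr xb \<le> (Cr * \<kappa>' + 2 * LH * \<kappa>' ^ 3) * t k powr ((1 + \<gamma>) * (q - 1))"
  proof eventually_elim
    case (elim k)
    let ?s = "t k powr (q - 1)"
    have a0: "0 \<le> a k" using \<kappa>' by (simp add: a_def)
    have "norm (z k - xs k) \<le> (1 + \<rho> * Lhat) * t k" unfolding z_def by (rule move_bound(1)[OF elim(1,2)])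
    then have zb: "norm (z k - xb) + a k < e2"
      using elim(3) norm_triangle_ineq[of "z k - xs k" "xs k - xb"] by simp
    have zU: "z k \<in> U" using elim(1) \<Gamma>_sub by (auto simp: inexact_step_def z_def)
    have "r (z k) \<le> Cr * ?s" unfolding z_def by (rule residual_after_step(2)[OF elim(1,2)])
    then have dz: "infdist (z k) Xs \<le> a k"
      unfolding a_def \<kappa>'_def using zb e2 a0 zU by (intro error_bound_powr) auto
    have bound: "Fr (z k) - Fr xb \<le> Cr * ?s * (a k + e) + 2 * LH * (a k + e) ^ 3" if e: "0 < e" "e < e2" for e
    proof -
      have "norm (z k - xb) + infdist (z k) Xs + e \<le> \<epsilon>b" using zb dz e e2 by linarith
      then obtain p where p: "p \<in> Xs" "p \<in> \<Gamma>" "norm (z k - p) < infdist (z k) Xs + e"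
        "norm (p - xb) < norm (z k - xb) + infdist (z k) Xs + e"
        using near_second_order_point e by blast
      have "Fr p \<le> Fr xb"
        using p(1,4) zb dz e e2 by (intro e1(2)) (auto simp: second_order_stationary_def)
      moreover have "Fr (z k) - Fr p \<le> Cr * ?s * norm (z k - p) + 2 * LH * norm (z k - p) ^ 3"
        using value_gap_after_step[OF elim(1,2) p(1,2)] by (simp add: z_def)
      moreover have np: "norm (z k - p) \<le> a k + e" using p dz by linarith
      moreover have "Cr * ?s * norm (z k - p) \<le> Cr * ?s * (a k + e)"
        using np Cr_pos by (intro mult_left_mono) auto
      moreover have "2 * LH * norm (z k - p) ^ 3 \<le> 2 * LH * (a k + e) ^ 3"
        using np LH by (intro mult_left_mono power_mono) auto
      ultimately show ?thesis by linarith
    qed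
    have "Fr (z k) - Fr xb \<le> Cr * ?s * (a k + 0) + 2 * LH * (a k + 0) ^ 3"
    proof (rule tendsto_lowerbound)
      show "((\<lambda>e. Cr * ?s * (a k + e) + 2 * LH * (a k + e) ^ 3) \<longlongrightarrow> Cr * ?s * (a k + 0) + 2 * LH * (a k + 0) ^ 3) (at_right 0)"
        by (intro tendsto_intros)
      show "\<forall>\<^sub>F e in at_right 0. Fr (z k) - Fr xb \<le> Cr * ?s * (a k + e) + 2 * LH * (a k + e) ^ 3"
        unfolding eventually_at_right_field using bound e2 by blast
    qed simp
    also have "?s * a k = \<kappa>' * t k powr ((1 + \<gamma>) * (q - 1))"
      by (simp add: a_def powr_add[symmetric] algebra_simps)
    then have "Cr * ?s * (a k + 0) = Cr * \<kappa>' * t k powr ((1 + \<gamma>) * (q - 1))" by (simp add: mult_ac)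
    also have "(a k + 0) ^ 3 \<le> \<kappa>' ^ 3 * t k powr ((1 + \<gamma>) * (q - 1))"
    proof -
      have "(1 + \<gamma>) * (q - 1) \<le> 3 * P"
      proof -
        have "1 / 2 \<le> 1 / (q - 1)" using q by (intro divide_left_mono) auto
        then have "1 + \<gamma> \<le> 3 * \<gamma>" using \<gamma> by linarith
        then show ?thesis using q mult_right_mono[of "1 + \<gamma>" "3 * \<gamma>" "q - 1"] by simp
      qed
      moreover have "(t k powr P) ^ 3 = t k powr (3 * P)"
        by (simp add: power3_eq_cube powr_add[symmetric])
      ultimately have "(t k powr P) ^ 3 \<le> t k powr ((1 + \<gamma>) * (q - 1))"
        using elim(2) by (cases "t k = 0") (auto intro: powr_mono')
      then show ?thesis using \<kappa>' by (simp add: a_def power_mult_distrib)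
    qed
    finally have "Fr (z k) - Fr xb \<le> (Cr * \<kappa>' + 2 * LH * \<kappa>' ^ 3) * t k powr ((1 + \<gamma>) * (q - 1))"
      using LH by (simp add: algebra_simps)
    then show ?case using next_value[of k] by (simp add: z_def)
  qed
  moreover have "0 < Cr * \<kappa>' + 2 * LH * \<kappa>' ^ 3" using Cr_pos \<kappa>' LH by (simp add: add_pos_pos)
  ultimately show ?thesis by blast
qed

text \<open>
  The error bound reads \<open>K dist\<^sup>p\<^sup>-\<^sup>1 \<le> r\<close> with \<open>p = (1 + \<gamma>)/\<gamma>\<close> and \<open>K = \<kappa> powr (- 1 / \<gamma>)\<close>, and the weak
  lower bound has coefficient \<open>a\<close> with \<open>a p = kh < K\<close>. It is assumed for the distance to the set of
  stationary points, which is at most the distance to \<open>Xs\<close>.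
\<close>

lemma value_growth:
  assumes \<epsilon>t: "0 < \<epsilon>t" and kh: "0 < kh" "kh < \<kappa> powr (- 1 / \<gamma>)"
    and low: "\<And>z. z \<in> D \<Longrightarrow> norm (z - xb) \<le> \<epsilon>t \<Longrightarrow>
      Fr xb - \<gamma> * kh / (1 + \<gamma>) * infdist z (stationary f g) powr ((1 + \<gamma>) / \<gamma>) \<le> Fr z"
  shows "\<exists>c>0. \<exists>R>0. \<forall>z\<in>D. norm (z - xb) \<le> R \<longrightarrow> Fr xb + c * infdist z Xs powr ((1 + \<gamma>) / \<gamma>) \<le> Fr z"
proof (rule error_bound_imp_growth[where k = kh and K = "\<kappa> powr (- 1 / \<gamma>)"
      and a = "\<gamma> * kh / (1 + \<gamma>)" and R = "min \<epsilon>b (min \<epsilon>h \<epsilon>t)"])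
  show "cball xb (min \<epsilon>b (min \<epsilon>h \<epsilon>t)) \<subseteq> U" using \<epsilon>b \<Gamma>_sub by auto
  show "0 < min \<epsilon>b (min \<epsilon>h \<epsilon>t)" using \<epsilon>b \<epsilon>h \<epsilon>t by simp
  show "infdist xb Xs = 0" by (rule infdist_xb)
  show "1 < (1 + \<gamma>) / \<gamma>" "0 \<le> \<gamma> * kh / (1 + \<gamma>)" using \<gamma>_pos kh by (auto simp: field_simps)
  have "1 + \<gamma> \<noteq> 0" using \<gamma>_pos by simp
  then show "\<gamma> * kh / (1 + \<gamma>) * ((1 + \<gamma>) / \<gamma>) \<le> kh" using \<gamma>_pos by simp
  show "kh < \<kappa> powr (- 1 / \<gamma>)" by (rule kh)
  fix z assume z: "z \<in> D" "norm (z - xb) \<le> min \<epsilon>b (min \<epsilon>h \<epsilon>t)"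
  have "infdist z Xs powr (1 / \<gamma>) \<le> (\<kappa> * r z powr \<gamma>) powr (1 / \<gamma>)"
    using error_bound[of z] z D_subset_U \<gamma>_pos infdist_nonneg by (intro powr_mono2) auto
  also have "\<dots> = \<kappa> powr (1 / \<gamma>) * r z"
    using \<kappa> \<gamma>_pos residual_nonneg by (simp add: powr_mult powr_powr)
  finally have "\<kappa> powr (- 1 / \<gamma>) * infdist z Xs powr (1 / \<gamma>) \<le> \<kappa> powr (- 1 / \<gamma>) * (\<kappa> powr (1 / \<gamma>) * r z)"
    by (intro mult_left_mono) auto
  also have "\<dots> = r z" using \<kappa> by (simp add: mult.assoc[symmetric] powr_add[symmetric])
  finally show "\<kappa> powr (- 1 / \<gamma>) * infdist z Xs powr ((1 + \<gamma>) / \<gamma> - 1) \<le> r z"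
    using \<gamma>_pos by (simp add: add_divide_distrib)
  have "infdist z (stationary f g) \<le> infdist z Xs"
    by (rule infdist_mono) (use Xs_nonempty in \<open>auto simp: second_order_stationary_def\<close>)
  then have "infdist z (stationary f g) powr ((1 + \<gamma>) / \<gamma>) \<le> infdist z Xs powr ((1 + \<gamma>) / \<gamma>)"
    using \<gamma>_pos infdist_nonneg by (intro powr_mono2) auto
  then have "\<gamma> * kh / (1 + \<gamma>) * infdist z (stationary f g) powr ((1 + \<gamma>) / \<gamma>)
      \<le> \<gamma> * kh / (1 + \<gamma>) * infdist z Xs powr ((1 + \<gamma>) / \<gamma>)"
    using \<gamma>_pos kh by (intro mult_left_mono) auto
  then show "Fr xb - \<gamma> * kh / (1 + \<gamma>) * infdist z Xs powr ((1 + \<gamma>) / \<gamma>) \<le> Fr z"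
    using low[of z] z by fastforce
qed

text \<open>
  The growth bound gives \<open>F(xb) \<le> F(xs k)\<close>, and the value gap gives convergence to \<open>F(xb)\<close> from
  above; the last claim chains value gap, step length and growth.
\<close>

lemma superlinear_decrease:
  assumes KL: "KL_at (\<lambda>z. f z + g z) xb"
    and \<epsilon>t: "0 < \<epsilon>t" and kh: "0 < kh" "kh < \<kappa> powr (- 1 / \<gamma>)"
    and low: "\<And>z. z \<in> D \<Longrightarrow> norm (z - xb) \<le> \<epsilon>t \<Longrightarrow>
      Fr xb - \<gamma> * kh / (1 + \<gamma>) * infdist z (stationary f g) powr ((1 + \<gamma>) / \<gamma>) \<le> Fr z"
  shows "\<forall>\<^sub>F k in sequentially. Fr xb \<le> Fr (xs k)"
    and "(\<lambda>k. Fr (xs k)) \<longlonglongrightarrow> Fr xb"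
    and "\<exists>M>0. \<forall>\<^sub>F k in sequentially. Fr (xs (Suc k)) - Fr xb \<le> M * (Fr (xs k) - Fr xb) powr P"
proof -
  let ?p = "(1 + \<gamma>) / \<gamma>" and ?e = "(1 + \<gamma>) * (q - 1)"
  obtain c R where c: "0 < c" and R: "0 < R"
    and growth: "\<And>z. z \<in> D \<Longrightarrow> norm (z - xb) \<le> R \<Longrightarrow> Fr xb + c * infdist z Xs powr ?p \<le> Fr z"
    using value_growth[OF assms(2-)] by blast
  have ev_near: "\<forall>\<^sub>F k in sequentially. norm (xs k - xb) \<le> e" if "0 < e" for e
    using metric_LIMSEQ_D[OF converges that] unfolding eventually_sequentially dist_norm
    by (meson less_imp_le)
  have ev_growth: "\<forall>\<^sub>F k in sequentially. Fr xb + c * d k powr ?p \<le> Fr (xs k)"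
    using ev_near[OF R] by eventually_elim (rule growth[OF xs_D])
  have lower: "Fr xb \<le> y" if "Fr xb + c * d k powr ?p \<le> y" for k y
    using that c by (smt (verit) mult_nonneg_nonneg powr_ge_zero)
  show ge: "\<forall>\<^sub>F k in sequentially. Fr xb \<le> Fr (xs k)"
    using ev_growth by eventually_elim (rule lower)
  obtain M where M: "0 < M" and gap: "\<forall>\<^sub>F k in sequentially. Fr (xs (Suc k)) - Fr xb \<le> M * t k powr ?e"
    using value_gap_le_step_length[OF KL] by blast
  have e_pos: "0 < ?e" using q \<gamma>_pos by simp
  have "(\<lambda>k. Fr (xs (Suc k)) - Fr xb) \<longlonglongrightarrow> 0"
  proof (rule tendsto_sandwich[of "\<lambda>_. 0" _ _ "\<lambda>k. M * t k powr ?e"])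
    show "\<forall>\<^sub>F k in sequentially. 0 \<le> Fr (xs (Suc k)) - Fr xb"
      using ge eventually_sequentially_Suc[of "\<lambda>k. Fr xb \<le> Fr (xs k)"] by simp
    have "(\<lambda>k. M * t k powr ?e) \<longlonglongrightarrow> M * 0 powr ?e"
      using e_pos by (intro tendsto_intros tendsto_powr' step_length_tendsto) auto
    then show "(\<lambda>k. M * t k powr ?e) \<longlonglongrightarrow> 0" by simp
  qed (use gap in auto)
  then have "(\<lambda>k. Fr (xs (Suc k))) \<longlonglongrightarrow> Fr xb" by (simp only: LIM_zero_iff)
  then show "(\<lambda>k. Fr (xs k)) \<longlonglongrightarrow> Fr xb" by (subst (asm) filterlim_sequentially_Suc)
  obtain C where C: "0 < C"
    and td: "\<forall>\<^sub>F k in sequentially. norm (xs k - xb) \<le> \<epsilon>b / 4 \<longrightarrow> t k \<le> C * d k"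
    using step_length_le_d by blast
  have "0 < \<epsilon>b / 4" using \<epsilon>b by simp
  from gap td ev_near[OF this] ev_growth
  have "\<forall>\<^sub>F k in sequentially. Fr (xs (Suc k)) - Fr xb
      \<le> (M * C powr ?e * (1 / c) powr P) * (Fr (xs k) - Fr xb) powr P"
  proof eventually_elim
    case (elim k)
    have "Fr (xs (Suc k)) - Fr xb \<le> M * t k powr ?e" by (rule elim)
    also have "\<dots> \<le> M * (C * d k) powr ?e"
      using elim M e_pos by (intro mult_left_mono powr_mono2) auto
    also have "\<dots> = M * C powr ?e * d k powr ?e"
      using C infdist_nonneg by (simp add: powr_mult)
    also have "d k powr ?e = (d k powr ?p) powr P"
      using \<gamma>_pos by (simp add: powr_powr)
    also have "M * C powr ?e * (d k powr ?p) powr P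
        \<le> M * C powr ?e * (1 / c * (Fr (xs k) - Fr xb)) powr P"
      using elim(4) c M C P_gt_1 by (intro mult_left_mono powr_mono2) (auto simp: field_simps)
    also have "(1 / c * (Fr (xs k) - Fr xb)) powr P = (1 / c) powr P * (Fr (xs k) - Fr xb) powr P"
      using c lower[OF elim(4)] by (subst powr_mult) auto
    finally show ?case by (simp add: mult.assoc)
  qed
  moreover have "0 < M * C powr ?e * (1 / c) powr P" using M C c by simp
  ultimately show "\<exists>M>0. \<forall>\<^sub>F k in sequentially. Fr (xs (Suc k)) - Fr xb \<le> M * (Fr (xs k) - Fr xb) powr P"
    by blast
qed

end

section \<open>The algorithm\<close>

theorem theorem4p8:
  fixes f g :: "'a::euclidean_space \<Rightarrow> ereal"
    and U N \<Gamma> :: "'a set"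
    and x :: "nat \<Rightarrow> 'a" and y :: "nat \<Rightarrow> nat \<Rightarrow> 'a"
    and L :: "nat \<Rightarrow> nat \<Rightarrow> real" and jk :: "nat \<Rightarrow> nat"
    and yk vk :: "nat \<Rightarrow> 'a" and Lk Fx :: "nat \<Rightarrow> real"
    and F :: "'a \<Rightarrow> ereal"
    and q Lm LM \<rho> \<sigma> \<tau> Lhat Lg LH \<epsilon>bar \<epsilon>hat \<epsilon>tilde s \<kappa> \<kappa>hat \<gamma> \<eta>0 \<eta> chat \<beta> Fbar :: real
    and kbar :: nat and xbar :: 'a
  assumes q: "2 < q" "q \<le> 3"
    and A1: "assumption_A1 f g U"
    and alg: "algorithm_run f g q Lm LM \<rho> \<sigma> \<tau> x y L jk"
    and A2: "assumption_A2 f U N x"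
    and F_def: "F = (\<lambda>z. f z + g z)"
    and yk_def: "yk = (\<lambda>k. y k (jk k))"
    and Lk_def: "Lk = (\<lambda>k. L k (jk k))"
    and vk_def: "vk = (\<lambda>k. R_model f g q (x k) (Lk k) (yk k))"
    and Lhat: "0 < Lhat" "\<forall>k. Lk k \<le> Lhat"
    and Gamma: "compact \<Gamma>" "convex \<Gamma>" "\<Gamma> \<subseteq> N"
    and eps_bar: "0 < \<epsilon>bar"
      "(\<Union>z\<in>accumulation_points x. cball z \<epsilon>bar) \<subseteq> \<Gamma>"
    and k_bar: "\<forall>k\<ge>kbar. x k \<in> (\<Union>z\<in>accumulation_points x. cball z (\<epsilon>bar / 2))
                    \<and> yk k \<in> \<Gamma> \<and> yk k - vk k \<in> \<Gamma>"
    and Lg: "0 < Lg" "Lg-lipschitz_on \<Gamma> (egrad f)"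
    and LH: "0 < LH" "LH-lipschitz_on \<Gamma> (ehess f)"
    and xbar: "xbar \<in> accumulation_points x"
    and KL: "KL_function F"
    and varsigma: "0 < s" "s < 1"
    and rho: "0 < \<rho>" "\<rho> < (1 - s) / (1 + s + Lg)"
    and err_consts: "0 < \<epsilon>hat" "0 < \<kappa>" "1 / (q - 1) < \<gamma>" "\<gamma> \<le> 1"
    and error_bound: "\<forall>z \<in> cball xbar \<epsilon>hat \<inter> U.
          edist_set z (second_order_stationary f g) \<le> ereal (\<kappa> * residual f g z powr \<gamma>)"
    and growth_consts: "0 < \<epsilon>tilde" "\<epsilon>tilde < \<epsilon>hat" "0 < \<kappa>hat" "\<kappa>hat < \<kappa> powr (- 1 / \<gamma>)"
    and growth: "\<forall>z \<in> cball xbar \<epsilon>tilde.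
          F z \<ge> F xbar -
            ereal (\<gamma> * \<kappa>hat / (1 + \<gamma>) * infdist z (stationary f g) powr ((1 + \<gamma>) / \<gamma>))"
    and eta0_def: "\<eta>0 = 1 - s - \<rho> * (1 + s + Lg)"
    and eta_def: "\<eta> = (2 + LH / Lm) / (2 * \<eta>0)
          + sqrt (2 * LH / (\<eta>0 * Lm) + (2 + LH / Lm)\<^sup>2 / \<eta>0\<^sup>2) / 2"
    and chat_def: "chat = ((3 + Lg) * \<rho> * Lhat + LH / 2 + Lhat) * \<eta> powr (q - 1)"
    and beta_def: "\<beta> = sqrt 2 * (\<rho> * (1 + Lg) + 1) * Lhat + sqrt 2 / 2 * LH"
    and Fx_def: "Fx = (\<lambda>k. real_of_ereal (F (x k)))"
    and Fbar_def: "Fbar = lim Fx"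
  shows "(\<exists>\<beta>0>0. \<forall>\<^sub>F k in sequentially.
            Fx (Suc k) - Fbar \<le>
              (2 * LH / 3 + \<beta> / sqrt 2) * \<eta> powr (q - 1)
              * max ((\<rho> * Lhat * \<eta> powr (q - 1) + \<kappa> * chat powr \<gamma>) ^ 3) 1
              * (\<beta>0 * (Fx k - Fbar)) powr (\<gamma> * (q - 1)))
         \<and> Q_superlinear_of_order Fx Fbar (\<gamma> * (q - 1))"
proof -
  interpret composite g f U
    using A1 by unfold_locales (auto simp: assumption_A1_def)
  have alg_params: "0 < Lm" "0 < \<sigma>" "1 < \<tau>" "x 0 \<in> D"
    using alg by (auto simp: algorithm_run_def)
  have alg_L0: "Lm \<le> L k 0" for k using alg by (auto simp: algorithm_run_def)
  have alg_inner: "norm (R_model f g q (x k) (L k j) (y k j)) \<le> \<rho> * L k j * norm (y k j - x k) powr (q - 1)"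
    if "j \<le> jk k" for k j
    using alg that by (auto simp: algorithm_run_def)
  have alg_L: "L k (Suc j) = \<tau> * L k j" if "j < jk k" for k j
    using alg that by (auto simp: algorithm_run_def)
  have alg_dec: "sufficient_decrease f g q \<sigma> (x k) (Lk k) (yk k)" for k
    using alg by (auto simp: algorithm_run_def Lk_def yk_def)
  have alg_next: "x (Suc k) = (if f (yk k) + g (yk k) < f (yk k - vk k) + g (yk k - vk k) then yk k else yk k - vk k)" for k
    using alg by (simp add: algorithm_run_def Lk_def yk_def vk_def Let_def)

  have "j \<le> jk k \<Longrightarrow> Lm \<le> L k j" for k j
  proof (induction j)
    case (Suc j)
    then have "Lm \<le> L k j" by simp
    also have "\<dots> \<le> \<tau> * L k j" using \<open>Lm \<le> L k j\<close> alg_params mult_right_mono[of 1 \<tau> "L k j"] by simp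
    finally show ?case using alg_L Suc by simp
  qed (rule alg_L0)
  then have Lk_ge: "Lm \<le> Lk k" for k by (simp add: Lk_def)

  have Lk_le: "Lk k \<le> Lhat" for k using Lhat by blast

  have prox_point: "yk k - vk k \<in> D" for k
    using prox_minimizes(1) by (simp add: vk_def R_model_def)
  have iterate: "yk k \<in> D \<and> Fr (yk k) \<le> Fr (x k) - \<sigma> * Lk k / q * norm (yk k - x k) powr q" if "x k \<in> D" for k
  proof -
    have le: "f (yk k) + g (yk k) \<le> f (x k) + g (x k) - ereal (\<sigma> * Lk k / q * norm (yk k - x k) powr q)"
      using alg_dec[of k] by (simp add: sufficient_decrease_def)
    then have "yk k \<in> D" using F_eq_PInfty[of "yk k"] F_eq_ereal[OF that] by fastforce
    then show ?thesis using le by (simp add: F_eq_ereal that)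
  qed
  have x_next: "x (Suc k) \<in> D \<and> Fr (x (Suc k)) \<le> Fr (yk k) \<and> Fr (x (Suc k)) \<le> Fr (yk k - vk k)
      \<and> (x (Suc k) = yk k \<or> x (Suc k) = yk k - vk k)" if "x k \<in> D" for k
    using alg_next[of k] iterate[OF that] prox_point[of k]
    by (auto simp: F_eq_ereal not_less split: if_splits)
  have xD: "x k \<in> D" for k
    by (induction k) (use alg_params x_next in auto)
  have FxD: "Fx k = Fr (x k)" for k
    using F_eq_ereal[OF xD[of k]] by (simp add: Fx_def F_def)

  have decrease: "\<sigma> * Lm / q * norm (yk k - x k) powr q \<le> Fx k - Fx (Suc k)" for k
  proof -
    have "\<sigma> * Lm / q * norm (yk k - x k) powr q \<le> \<sigma> * Lk k / q * norm (yk k - x k) powr q"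
      using Lk_ge alg_params q by (intro mult_right_mono divide_right_mono mult_left_mono) auto
    then show ?thesis using iterate[OF xD] x_next[OF xD] unfolding FxD by (smt (verit))
  qed
  have "decseq Fx"
  proof (rule decseq_SucI)
    fix k
    have "0 \<le> \<sigma> * Lm / q * norm (yk k - x k) powr q" using alg_params q by simp
    then show "Fx (Suc k) \<le> Fx k" using decrease[of k] by linarith
  qed
  moreover obtain c where "\<And>z. ereal c \<le> f z + g z" using A1 by (auto simp: assumption_A1_def)
  then have "c \<le> Fx k" for k using F_eq_ereal[OF xD[of k]] FxD by (metis ereal_less_eq(3))
  ultimately obtain l where l: "Fx \<longlonglongrightarrow> l" using decseq_convergent by metis
  have step_tendsto: "(\<lambda>k. norm (yk k - x k)) \<longlonglongrightarrow> 0"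
  proof -
    have pos: "0 < \<sigma> * Lm / q" using alg_params q by simp
    have "(\<lambda>k. Fx k - Fx (Suc k)) \<longlonglongrightarrow> l - l"
      by (intro tendsto_diff l LIMSEQ_Suc)
    then have diff: "(\<lambda>k. Fx k - Fx (Suc k)) \<longlonglongrightarrow> 0" by (simp only: diff_self)
    have "(\<lambda>k. \<sigma> * Lm / q * norm (yk k - x k) powr q) \<longlonglongrightarrow> 0"
    proof (rule tendsto_sandwich[OF _ _ tendsto_const diff])
      show "\<forall>\<^sub>F k in sequentially. 0 \<le> \<sigma> * Lm / q * norm (yk k - x k) powr q"
        using pos by (intro always_eventually allI mult_nonneg_nonneg) auto
      show "\<forall>\<^sub>F k in sequentially. \<sigma> * Lm / q * norm (yk k - x k) powr q \<le> Fx k - Fx (Suc k)"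
        using decrease by (intro always_eventually allI)
    qed
    then have "(\<lambda>k. norm (yk k - x k) powr q) \<longlonglongrightarrow> 0"
      using tendsto_mult_left_iff[OF less_imp_neq[OF pos, symmetric], of "\<lambda>k. norm (yk k - x k) powr q" 0]
      by (simp only: mult_zero_right)
    then have "(\<lambda>k. (norm (yk k - x k) powr q) powr (1 / q)) \<longlonglongrightarrow> 0 powr (1 / q)"
      using q by (intro tendsto_powr') auto
    then show ?thesis using q by (simp add: powr_powr)
  qed

  have \<Gamma>U: "\<Gamma> \<subseteq> U" using Gamma A2 by (auto simp: assumption_A2_def)
  have rho_Lg: "\<rho> * (1 + Lg) < 1"
  proof -
    have "\<rho> * (1 + s + Lg) < 1 - s" using rho varsigma Lg by (simp add: pos_less_divide_eq)
    moreover have "\<rho> * (1 + Lg) \<le> \<rho> * (1 + s + Lg)" using rho varsigma by (intro mult_left_mono) auto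
    ultimately show ?thesis using varsigma by linarith
  qed
  interpret regularized_newton g f U \<Gamma> q \<rho> Lm Lhat Lg LH
    by unfold_locales (use Gamma \<Gamma>U Lg LH q rho rho_Lg alg_params Lhat in auto)
  have step: "inexact_step (x k) (Lk k) (yk k)" if "kbar \<le> k" for k
  proof -
    obtain z where z: "z \<in> accumulation_points x" "x k \<in> cball z (\<epsilon>bar / 2)" using k_bar \<open>kbar \<le> k\<close> by blast
    have "ball (x k) (\<epsilon>bar / 2) \<subseteq> cball z \<epsilon>bar"
    proof
      fix w assume "w \<in> ball (x k) (\<epsilon>bar / 2)"
      then show "w \<in> cball z \<epsilon>bar" using z(2) dist_triangle[of z w "x k"] by auto
    qed
    then have "x k \<in> interior \<Gamma>"
      using eps_bar z(1) by (intro interiorI[OF open_ball, of _ "x k" "\<epsilon>bar / 2"]) auto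
    then show ?thesis
      using k_bar that Lk_le[of k] Lk_ge alg_inner[of "jk k" k]
      by (auto simp: inexact_step_def vk_def Lk_def yk_def)
  qed
  interpret newton_sequence g f U \<Gamma> q \<rho> Lm Lhat Lg LH x yk Lk kbar xbar \<epsilon>bar
  proof
    show "cball xbar \<epsilon>bar \<subseteq> \<Gamma>" using eps_bar xbar by blast
  qed (use xD step x_next[OF xD] step_tendsto xbar eps_bar in \<open>auto simp: vk_def\<close>)

  have xbarD: "xbar \<in> D" using accumulation_point_stationary by (simp add: stationary_iff subgradient_def)
  have "edist_set xbar Xs \<le> ereal (\<kappa> * r xbar powr \<gamma>)"
    using error_bound xb_in(2) err_consts by simp
  then have XsN: "Xs \<noteq> {}" by (auto simp: edist_set_def)
  interpret newton_sequence_error_bound g f U \<Gamma> q \<rho> Lm Lhat Lg LH x yk Lk kbar xbar \<epsilon>bar \<epsilon>hat \<kappa> \<gamma>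
  proof
    show "infdist z Xs \<le> \<kappa> * r z powr \<gamma>" if "z \<in> U" "norm (z - xbar) \<le> \<epsilon>hat" for z
      using error_bound that XsN by (auto simp: edist_set_def dist_norm norm_minus_commute)
  qed (use err_consts XsN in auto)
  have KL': "KL_at (\<lambda>z. f z + g z) xbar"
    using KL accumulation_point_stationary by (auto simp: KL_function_def F_def stationary_def)
  have low: "Fr xbar - \<gamma> * \<kappa>hat / (1 + \<gamma>) * infdist z (stationary f g) powr ((1 + \<gamma>) / \<gamma>) \<le> Fr z"
    if "z \<in> D" "norm (z - xbar) \<le> \<epsilon>tilde" for z
  proof -
    have "z \<in> cball xbar \<epsilon>tilde" using that by (simp add: dist_norm norm_minus_commute)
    then show ?thesis
      using growth by (force simp: F_def F_eq_ereal[OF that(1)] F_eq_ereal[OF xbarD])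
  qed
  have Fx_eq: "Fx = (\<lambda>k. Fr (x k))" using FxD by blast
  note super_rules = superlinear_decrease[OF KL' growth_consts(1,3,4)]
  have super: "\<forall>\<^sub>F k in sequentially. Fr xbar \<le> Fx k" "Fx \<longlonglongrightarrow> Fr xbar"
    "\<exists>M>0. \<forall>\<^sub>F k in sequentially. Fx (Suc k) - Fr xbar \<le> M * (Fx k - Fr xbar) powr (\<gamma> * (q - 1))"
    unfolding Fx_eq by (rule super_rules; rule low; assumption)+
  obtain M where M: "0 < M"
    and decr: "\<forall>\<^sub>F k in sequentially. Fx (Suc k) - Fr xbar \<le> M * (Fx k - Fr xbar) powr (\<gamma> * (q - 1))"
    using super(3) by blast
  have Fbar: "Fbar = Fr xbar" unfolding Fbar_def using super(2) limI by blast

  define K where "K = (2 * LH / 3 + \<beta> / sqrt 2) * \<eta> powr (q - 1)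
              * max ((\<rho> * Lhat * \<eta> powr (q - 1) + \<kappa> * chat powr \<gamma>) ^ 3) 1"
  have K: "0 < K"
  proof -
    have "\<rho> * (1 + s + Lg) < 1 - s" using rho varsigma Lg by (simp add: pos_less_divide_eq)
    then have "0 < \<eta>0" by (simp add: eta0_def)
    then have "0 < \<eta>" unfolding eta_def using LH alg_params by (intro add_pos_nonneg) (auto intro!: add_pos_pos divide_pos_pos)
    moreover have "0 < \<beta>" unfolding beta_def using rho Lg Lhat LH by (intro add_pos_pos mult_pos_pos) auto
    ultimately show ?thesis unfolding K_def using LH by (intro mult_pos_pos add_pos_pos) auto
  qed
  \<comment> \<open>Chosen so that \<open>K\<close> times \<open>\<beta>0\<close> to the power \<open>\<gamma> (q - 1)\<close> is \<open>M\<close>.\<close>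
  define \<beta>0 where "\<beta>0 = (M / K) powr (1 / (\<gamma> * (q - 1)))"
  have \<beta>0: "0 < \<beta>0" using M K by (simp add: \<beta>0_def)
  have "\<forall>\<^sub>F k in sequentially. Fx (Suc k) - Fbar \<le> K * (\<beta>0 * (Fx k - Fbar)) powr (\<gamma> * (q - 1))"
    using decr super(1)
  proof eventually_elim
    case (elim k)
    have "K * (\<beta>0 * (Fx k - Fbar)) powr (\<gamma> * (q - 1)) = M * (Fx k - Fbar) powr (\<gamma> * (q - 1))"
      using elim(2) \<beta>0 M K P_gt_1 \<gamma>_pos q by (simp add: Fbar powr_mult \<beta>0_def powr_powr)
    then show ?case using elim(1) by (simp add: Fbar)
  qed
  moreover have "Q_superlinear_of_order Fx Fbar (\<gamma> * (q - 1))"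
    unfolding Q_superlinear_of_order_def
  proof (intro conjI exI[of _ M])
    show "1 < \<gamma> * (q - 1)" by (rule P_gt_1)
    show "Fx \<longlonglongrightarrow> Fbar" unfolding Fbar by (rule super(2))
    have "\<forall>\<^sub>F k in sequentially. Fr xbar \<le> Fx (Suc k)"
      using super(1) eventually_sequentially_Suc[of "\<lambda>k. Fr xbar \<le> Fx k"] by simp
    with super(1) decr
    show "\<forall>\<^sub>F k in sequentially. \<bar>Fx (Suc k) - Fbar\<bar> \<le> M * \<bar>Fx k - Fbar\<bar> powr (\<gamma> * (q - 1))"
      by eventually_elim (simp add: Fbar)
  qed (rule M)
  ultimately show ?thesis using \<beta>0 unfolding K_def by blast
qed

end
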